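(* Let $G$ be a connected accessible graph and $B$ any block of $G$. Let $V=\{v_1,\dots,v_k\}$ be the set of cut vertices of $G$ belonging to $V(B)$. Then for any $W\subseteq V$, the graph $\overline{B}^{W}$ is accessible. In particular, $\overline{B}=\overline{B}^{V}$ is accessible.
   Context: All graphs are finite and simple. For a graph $G$ on $[n]=\{1,\dots,n\}$ and a field $K$, the binomial edge ideal $J_G\subseteq K[x_1,\dots,x_n,y_1,\dots,y_n]$ is generated by all $x_iy_j-x_jy_i$ with $\{i,j\}\in E(G)$, $i<j$. For $T\subseteq V(G)$, $G\setminus T$ is the induced subgraph on $V(G)\setminus T$ and $c_G(T)$ is its number of connected components. A cut vertex is a vertex whose removal increases the number of connected components. A set $T\subseteq V(G)$ is a cutset if each $t\in T$ is a cut vertex of $G\setminus(T\setminus\{t\})$; $\mathfrak{C}(G)$ is the set of all cutsets. $J_G$ is unmixed if all its minimal primes have the same height; equivalently $c_G(T)=|T|+c$ for all $T\in\mathfrak{C}(G)$, where $c$ is the number of connected components of $G$. $G$ is accessible if $J_G$ is unmixed and for every non-empty $T\in\mathfrak{C}(G)$ there is $t\in T$ with $T\setminus\{t\}\in\mathfrak{C}(G)$. A block of a connected graph $G$ is a maximal connected induced subgraph having no cut vertex of its own. Let $G$ be connected with $J_G$ unmixed, $B$ a block of $G$, and $V=\{v_1,\dots,v_k\}$ the cut vertices of $G$ in $V(B)$. Then $G=B\cup\bigcup_{i=1}^kG_i$, where $V(G_i)\cap V(B)=\{v_i\}$ and $G_i\setminus\{v_i\}$ is the connected component of $G\setminus\{v_i\}$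 not meeting $B$ ($G_i$ is the induced subgraph on this component together with $v_i$). For $W\subseteq V$, $\overline{B}^{W}$ is the graph with vertex set $V(B)\cup\bigcup_{v_i\notin W}V(G_i)\cup\{f_v: v\in W\}$, the $f_v$ being new vertices, and edge set $E(B)\cup\bigcup_{v_i\in V\setminus W}E(G_i)\cup\{\{v,f_v\}: v\in W\}$; that is, for each $v_i\in W$ the part $G_i$ is replaced by a whisker at $v_i$. $\overline{B}=\overline{B}^{V}$. *)

theory Defs
  imports
    "HOL-Algebra.Ideal"
    "HOL-Library.Poly_Mapping"
    "HOL-Library.Extended_Nat"
begin

section \<open>Finite simple graphs\<close>

datatype 'a graph = Graph (verts: "'a set") (edges: "'a set set")

definition simple_graph :: "'a graph \<Rightarrow> bool" where
  "simple_graph G \<longleftrightarrow> finite (verts G) \<and> (\<forall>e\<in>edges G. e \<subseteq> verts G \<and> card e = 2)"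

definition induced :: "'a graph \<Rightarrow> 'a set \<Rightarrow> 'a graph" where
  "induced G S = Graph (verts G \<inter> S) {e \<in> edges G. e \<subseteq> S}"

definition remove :: "'a graph \<Rightarrow> 'a set \<Rightarrow> 'a graph" where
  "remove G T = induced G (verts G - T)"

definition linked :: "'a graph \<Rightarrow> ('a \<times> 'a) set" where
  "linked G = {(u, v). u \<in> verts G \<and> v \<in> verts G \<and> (u, v) \<in> {(a, b). {a, b} \<in> edges G}\<^sup>*}"

text \<open>Connected components, as vertex sets.\<close>

definition components :: "'a graph \<Rightarrow> 'a set set" where
  "components G = verts G // linked G"

definition graph_connected :: "'a graph \<Rightarrow> bool" where
  "graph_connected G \<longleftrightarrow> verts G \<noteq> {} \<and> (\<forall>u\<in>verts G. \<forall>v\<in>verts G. (u, v) \<in> linked G)"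

definition cut_vertex :: "'a graph \<Rightarrow> 'a \<Rightarrow> bool" where
  "cut_vertex G v \<longleftrightarrow> v \<in> verts G \<and> card (components G) < card (components (remove G {v}))"

definition cutset :: "'a graph \<Rightarrow> 'a set \<Rightarrow> bool" where
  "cutset G T \<longleftrightarrow> T \<subseteq> verts G \<and> (\<forall>t\<in>T. cut_vertex (remove G (T - {t})) t)"

definition nonseparable :: "'a graph \<Rightarrow> bool" where
  "nonseparable H \<longleftrightarrow> graph_connected H \<and> (\<forall>v. \<not> cut_vertex H v)"

definition is_block :: "'a graph \<Rightarrow> 'a graph \<Rightarrow> bool" where
  "is_block G B \<longleftrightarrow>
     (\<exists>S\<subseteq>verts G. B = induced G S) \<and> nonseparable B \<and>
     (\<forall>S. verts B \<subset> S \<and> S \<subseteq> verts G \<longrightarrow> \<not> nonseparable (induced G S))"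

definition block_cut_verts :: "'a graph \<Rightarrow> 'a graph \<Rightarrow> 'a set" where
  "block_cut_verts G B = {v \<in> verts B. cut_vertex G v}"

text \<open>
  The part of \<open>G\<close> attached to the block \<open>B\<close> at the cut vertex \<open>v\<close>. When \<open>G\<close> is connected and
  its binomial edge ideal is unmixed, \<open>G - v\<close> has exactly two components, and exactly one of
  them does not meet \<open>B\<close>; the description is meaningful only in that situation.
\<close>

definition branch :: "'a graph \<Rightarrow> 'a graph \<Rightarrow> 'a \<Rightarrow> 'a graph" where
  "branch G B v =
     induced G (insert v (THE C. C \<in> components (remove G {v}) \<and> C \<inter> verts B = {}))"

text \<open>
  The branches at the vertices of \<open>W\<close> are replaced by whiskers. \<open>Inl u\<close> is the old vertex \<open>u\<close>,
  and \<open>Inr v\<close> is the new leaf \<open>f\<^sub>v\<close> at \<open>v\<close>.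
\<close>

definition whiskered :: "'a graph \<Rightarrow> 'a graph \<Rightarrow> 'a set \<Rightarrow> ('a + 'a) graph" where
  "whiskered G B W = Graph
     (Inl ` (verts B \<union> (\<Union>v\<in>block_cut_verts G B - W. verts (branch G B v))) \<union> Inr ` W)
     ((`) Inl ` (edges B \<union> (\<Union>v\<in>block_cut_verts G B - W. edges (branch G B v)))
        \<union> {{Inl v, Inr v} |v. v \<in> W})"


lemma simple_graph_induced: "simple_graph G \<Longrightarrow> simple_graph (induced G S)"
  by (auto simp: simple_graph_def induced_def)

lemma simple_graph_whiskered:
  assumes "simple_graph G" "is_block G B" "W \<subseteq> block_cut_verts G B"
  shows "simple_graph (whiskered G B W)"
proof -
  let ?V = "verts B \<union> (\<Union>v\<in>block_cut_verts G B - W. verts (branch G B v))"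
  let ?E = "edges B \<union> (\<Union>v\<in>block_cut_verts G B - W. edges (branch G B v))"
  have B: "simple_graph B"
    using assms(1,2) simple_graph_induced unfolding is_block_def by blast
  have br: "simple_graph (branch G B v)" for v
    unfolding branch_def using assms(1) by (rule simple_graph_induced)
  have cv: "block_cut_verts G B \<subseteq> verts B"
    by (auto simp: block_cut_verts_def)
  have fin: "finite (block_cut_verts G B)" "finite W"
    using B cv assms(3) by (auto simp: simple_graph_def intro: finite_subset)
  have V: "finite ?V"
    using fin B br by (auto simp: simple_graph_def)
  have E: "e \<subseteq> ?V \<and> card e = 2" if "e \<in> ?E" for e
    using that B br unfolding simple_graph_def by blast
  have "e' \<subseteq> verts (whiskered G B W) \<and> card e' = 2" if "e' \<in> edges (whiskered G B W)" for e'
  proof -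
    have "e' \<in> (`) Inl ` ?E \<or> e' \<in> {{Inl v, Inr v} |v. v \<in> W}"
      using that unfolding whiskered_def graph.sel by (rule UnE) (rule disjI1, assumption, rule disjI2, assumption)
    then show ?thesis
    proof
      assume "e' \<in> (`) Inl ` ?E"
      then obtain e where e: "e' = Inl ` e" "e \<in> ?E" by (rule imageE)
      have "card e' = 2"
        using E[OF e(2)] unfolding e(1) by (simp add: card_image)
      moreover have "e' \<subseteq> Inl ` ?V"
        unfolding e(1) using E[OF e(2)] by (intro image_mono) (rule conjunct1)
      ultimately show ?thesis
        unfolding whiskered_def graph.sel by (intro conjI le_supI1)
    next
      assume "e' \<in> {{Inl v, Inr v} |v. v \<in> W}"
      then obtain v where v: "e' = {Inl v, Inr v}" "v \<in> W" by blast
      then have "v \<in> verts B" using assms(3) cv by blast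
      then show ?thesis using v by (simp add: whiskered_def)
    qed
  qed
  moreover have "finite (verts (whiskered G B W))"
    using V fin by (simp add: whiskered_def)
  ultimately show ?thesis by (simp add: simple_graph_def)
qed


section \<open>Polynomial rings and heights of ideals\<close>

text \<open>
  \<open>('v \<Rightarrow>\<^sub>0 nat) \<Rightarrow>\<^sub>0 'k\<close> is the type of all polynomials with variables from \<open>'v\<close>;
  the ring \<open>K[V]\<close> consists of those in which only variables from \<open>V\<close> occur.
\<close>

type_synonym ('v, 'k) mpoly = "('v \<Rightarrow>\<^sub>0 nat) \<Rightarrow>\<^sub>0 'k"

definition mpoly_ring :: "'v set \<Rightarrow> ('v, 'k::field) mpoly ring" where
  "mpoly_ring V =
     \<lparr>carrier = {p. \<forall>m\<in>Poly_Mapping.keys p. Poly_Mapping.keys m \<subseteq> V},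
      monoid.mult = (*), one = 1, zero = 0, add = (+)\<rparr>"

lemma cring_mpoly_ring: "cring (mpoly_ring V :: ('v, 'k::field) mpoly ring)"
proof -
  let ?C = "{p :: ('v, 'k) mpoly. \<forall>m\<in>Poly_Mapping.keys p. Poly_Mapping.keys m \<subseteq> V}"
  have add: "p + q \<in> ?C" if "p \<in> ?C" "q \<in> ?C" for p q
    using that keys_add[of p q] by blast
  have mult: "p * q \<in> ?C" if "p \<in> ?C" "q \<in> ?C" for p q
  proof (rule CollectI, rule ballI)
    fix m assume "m \<in> Poly_Mapping.keys (p * q)"
    then obtain a b where "m = a + b" "a \<in> Poly_Mapping.keys p" "b \<in> Poly_Mapping.keys q"
      using keys_mult[of p q] by blast
    then show "Poly_Mapping.keys m \<subseteq> V"
      using that keys_add[of a b] by blast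
  qed
  have neg: "- p \<in> ?C" if "p \<in> ?C" for p
    using that by (simp add: keys_minus)
  let ?R = "mpoly_ring V :: ('v, 'k) mpoly ring"
  have sel: "carrier ?R = ?C" "mult ?R = (*)" "one ?R = 1" "zero ?R = 0" "add ?R = (+)"
    by (simp_all add: mpoly_ring_def)
  have one: "1 \<in> ?C" and zero: "0 \<in> ?C"
    by simp_all
  have ag: "abelian_group ?R"
  proof (rule abelian_groupI, unfold sel)
    fix x assume "x \<in> ?C"
    then show "\<exists>y\<in>?C. y + x = 0" using neg[of x] by (intro bexI[of _ "- x"]) simp_all
  qed (simp_all only: add zero ac_simps add_0_left add_0_right)
  have cm: "comm_monoid ?R"
    by (rule comm_monoidI, unfold sel) (simp_all only: mult one ac_simps mult_1_left mult_1_right)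
  show ?thesis
    by (rule cringI[OF ag cm], unfold sel) (rule distrib_right)
qed

definition minimal_prime :: "('r, 'm) ring_scheme \<Rightarrow> 'r set \<Rightarrow> 'r set \<Rightarrow> bool" where
  "minimal_prime R I P \<longleftrightarrow>
     primeideal P R \<and> I \<subseteq> P \<and> (\<forall>Q. primeideal Q R \<and> I \<subseteq> Q \<and> Q \<subseteq> P \<longrightarrow> Q = P)"

definition prime_height :: "('r, 'm) ring_scheme \<Rightarrow> 'r set \<Rightarrow> enat" where
  "prime_height R P =
     Sup {enat n |n. \<exists>c :: nat \<Rightarrow> 'r set.
            (\<forall>i\<le>n. primeideal (c i) R) \<and> (\<forall>i<n. c i \<subset> c (Suc i)) \<and> c n = P}"

definition unmixed :: "('r, 'm) ring_scheme \<Rightarrow> 'r set \<Rightarrow> bool" where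
  "unmixed R I \<longleftrightarrow>
     (\<forall>P Q. minimal_prime R I P \<and> minimal_prime R I Q \<longrightarrow> prime_height R P = prime_height R Q)"


section \<open>Binomial edge ideals and accessible graphs\<close>

datatype 'a xyvar = XV 'a | YV 'a

definition var :: "'v \<Rightarrow> ('v, 'k::field) mpoly" where
  "var v = Poly_Mapping.single (Poly_Mapping.single v 1) 1"

definition edge_ring :: "'a graph \<Rightarrow> ('a xyvar, 'k::field) mpoly ring" where
  "edge_ring G = mpoly_ring (XV ` verts G \<union> YV ` verts G)"

text \<open>
  The vertices are not assumed to be ordered: each edge contributes its binomial with both
  signs, which does not affect the generated ideal.
\<close>

definition binomial_edge_ideal :: "'a graph \<Rightarrow> ('a xyvar, 'k::field) mpoly set" where
  "binomial_edge_ideal G =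
     Idl\<^bsub>edge_ring G\<^esub> {var (XV i) * var (YV j) - var (XV j) * var (YV i) |i j. {i, j} \<in> edges G}"

lemma ideal_binomial_edge_ideal:
  assumes "simple_graph G"
  shows "ideal (binomial_edge_ideal G :: ('a xyvar, 'k::field) mpoly set) (edge_ring G)"
proof -
  let ?U = "XV ` verts G \<union> YV ` verts G"
  let ?R = "edge_ring G :: ('a xyvar, 'k) mpoly ring"
  interpret cring ?R
    unfolding edge_ring_def by (rule cring_mpoly_ring)
  have "var (XV i) * var (YV j) - var (XV j) * var (YV i) \<in> carrier ?R"
    if "{i, j} \<in> edges G" for i j
  proof -
    have ij: "i \<in> verts G" "j \<in> verts G"
      using assms that by (auto simp: simple_graph_def)
    have keys: "Poly_Mapping.keys (var (XV u) * var (YV v) :: ('a xyvar, 'k) mpoly)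
        = {Poly_Mapping.single (XV u) 1 + Poly_Mapping.single (YV v) 1}" for u v
      by (simp add: var_def mult_single)
    have sub: "Poly_Mapping.keys (Poly_Mapping.single (XV u) (1::nat) + Poly_Mapping.single (YV v) 1) \<subseteq> ?U"
      if "u \<in> verts G" "v \<in> verts G" for u v
      using keys_add[of "Poly_Mapping.single (XV u) (1::nat)" "Poly_Mapping.single (YV v) 1"] that
      by auto
    show ?thesis
      unfolding edge_ring_def mpoly_ring_def partial_object.simps
    proof (rule CollectI, rule ballI)
      fix m
      assume "m \<in> Poly_Mapping.keys (var (XV i) * var (YV j) - var (XV j) * var (YV i) :: ('a xyvar, 'k) mpoly)"
      then have "m \<in> Poly_Mapping.keys (var (XV i) * var (YV j) :: ('a xyvar, 'k) mpoly)
          \<union> Poly_Mapping.keys (var (XV j) * var (YV i) :: ('a xyvar, 'k) mpoly)"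
        by (rule set_mp[OF keys_diff])
      then consider "m = Poly_Mapping.single (XV i) 1 + Poly_Mapping.single (YV j) 1"
        | "m = Poly_Mapping.single (XV j) 1 + Poly_Mapping.single (YV i) 1"
        unfolding keys by blast
      then show "Poly_Mapping.keys m \<subseteq> ?U"
        by cases (simp_all only: sub ij)
    qed
  qed
  then show ?thesis
    unfolding binomial_edge_ideal_def by (intro genideal_ideal) blast
qed

definition accessible :: "'k::field itself \<Rightarrow> 'a graph \<Rightarrow> bool" where
  "accessible K G \<longleftrightarrow>
     unmixed (edge_ring G) (binomial_edge_ideal G :: ('a xyvar, 'k) mpoly set) \<and>
     (\<forall>T. cutset G T \<and> T \<noteq> {} \<longrightarrow> (\<exists>t\<in>T. cutset G (T - {t})))"

end

theory Submission
  imports Defs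
begin

text \<open>
  Write \<open>c\<^sub>G(T)\<close> for the number of components of \<open>G - T\<close>.

  The combinatorial heart is that \<open>B\<close> with whiskers at \<open>W\<close> is the contraction \<open>H\<close> of \<open>G\<close> in which, for
  each \<open>v \<in> W\<close>, the branch at \<open>v\<close> without \<open>v\<close> shrinks to the leaf at \<open>v\<close>. The contracted sets are
  connected and hang on the rest of \<open>G\<close> at \<open>v\<close> only, so \<open>c\<^sub>H(T) = c\<^sub>G(T)\<close> for each set \<open>T\<close> of vertices that
  are not contracted (\<open>card_components_whiskered\<close>). Whether \<open>T\<close> is a cutset depends only on the numbers
  \<open>c(T)\<close> and \<open>c(T - {t})\<close>, and a leaf is never in a cutset. Hence the cutsets of \<open>H\<close> are the cutsets of \<open>G\<close>
  that avoid the contracted sets, and they form a family that is closed under passing to smaller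
  cutsets. Both conditions in the definition of accessibility, once they are expressed by the
  numbers \<open>c(T)\<close>, are inherited by \<open>H\<close>. That \<open>G\<close> is the union of the block and its branches, with
  branches at different cut vertices disjoint, follows from the maximality of the block: a
  component outside the block that touched it in two vertices would provide an ear.

  The algebraic part shows that the binomial edge ideal is unmixed exactly if \<open>c(T) = card T + c({})\<close>
  for all cutsets \<open>T\<close> (\<open>unmixed_iff\<close>). The prime \<open>P\<^sub>T\<close> is defined as the kernel of a monomial parametrisation of matrices with two rows whose
  columns vanish for \<open>i \<in> T\<close> and are proportional within each component of \<open>G - T\<close>. Every prime that
  contains the ideal contains some \<open>P\<^sub>T\<close> (\<open>segre_prime_subset\<close>, \<open>prime_contains_cut_prime\<close>), and the
  minimal ones among the \<open>P\<^sub>T\<close> belong to the cutsets. The height of \<open>P\<^sub>T\<close> is read off from an explicit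
  chain of primes through \<open>P\<^sub>T\<close> whose length is the number of variables (\<open>height_segre_prime\<close>). That
  no chain of primes is longer (\<open>has_chain_le\<close>) is seen by counting: in a strict inclusion of primes
  the Hilbert function of the quotient loses one order of growth.
\<close>

abbreviation (input) keys :: "('a \<Rightarrow>\<^sub>0 'b::zero) \<Rightarrow> 'a set" where "keys \<equiv> Poly_Mapping.keys"
abbreviation (input) lookup :: "('a \<Rightarrow>\<^sub>0 'b::zero) \<Rightarrow> 'a \<Rightarrow> 'b" where "lookup \<equiv> Poly_Mapping.lookup"
abbreviation (input) single :: "'a \<Rightarrow> 'b \<Rightarrow> 'a \<Rightarrow>\<^sub>0 'b::zero" where "single \<equiv> Poly_Mapping.single"

section \<open>Substitution in polynomials\<close>

lemma poly_mapping_sum_singles: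
  fixes p :: "'a \<Rightarrow>\<^sub>0 'b::comm_monoid_add"
  shows "p = (\<Sum>m\<in>keys p. single m (lookup p m))"
proof (rule poly_mapping_eqI)
  fix k
  have "lookup (\<Sum>m\<in>keys p. single m (lookup p m)) k
      = (\<Sum>m\<in>keys p. if m = k then lookup p m else 0)"
    by (simp add: lookup_sum lookup_single when_def)
  also have "\<dots> = lookup p k"
    by (simp add: in_keys_iff)
  finally show "lookup p k = lookup (\<Sum>m\<in>keys p. single m (lookup p m)) k" by simp
qed

lemma mpoly_induct [case_names single add]:
  fixes p :: "'a \<Rightarrow>\<^sub>0 'b::comm_monoid_add"
  assumes "\<And>m c. P (single m c)" "\<And>p q. P p \<Longrightarrow> P q \<Longrightarrow> P (p + q)"
  shows "P p"
proof -
  have "P (\<Sum>m\<in>A. single m (lookup p m))" if "finite A" for A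
    using that
  proof induction
    case empty
    then show ?case using assms(1)[of undefined 0] by simp
  qed (simp add: assms)
  from this[of "keys p"] show ?thesis
    using poly_mapping_sum_singles[of p] by simp
qed

text \<open>
  Substitution of polynomials for variables is the case of a multiplicative \<open>\<rho>\<close>. The proof that a
  Segre prime lies below every prime containing its minors needs the \<open>K\<close>-linear extension of a map
  on monomials that is not multiplicative.
\<close>

definition lin_ext :: "(('v \<Rightarrow>\<^sub>0 nat) \<Rightarrow> ('w, 'k::field) mpoly) \<Rightarrow> ('v, 'k) mpoly \<Rightarrow> ('w, 'k) mpoly" where
  "lin_ext \<rho> p = (\<Sum>m\<in>keys p. single 0 (lookup p m) * \<rho> m)"

lemma lin_ext_superset:
  "finite A \<Longrightarrow> keys p \<subseteq> A \<Longrightarrow> lin_ext \<rho> p = (\<Sum>m\<in>A. single 0 (lookup p m) * \<rho> m)"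
  unfolding lin_ext_def by (rule sum.mono_neutral_left) (auto simp: in_keys_iff)

lemma lin_ext_add: "lin_ext \<rho> (p + q) = lin_ext \<rho> p + lin_ext \<rho> q"
proof -
  let ?A = "keys p \<union> keys q"
  have "lin_ext \<rho> (p + q) = (\<Sum>m\<in>?A. single 0 (lookup (p + q) m) * \<rho> m)"
    by (rule lin_ext_superset) (auto simp: keys_add)
  also have "\<dots> = (\<Sum>m\<in>?A. single 0 (lookup p m) * \<rho> m) + (\<Sum>m\<in>?A. single 0 (lookup q m) * \<rho> m)"
    by (simp add: lookup_add single_add distrib_right sum.distrib)
  also have "\<dots> = lin_ext \<rho> p + lin_ext \<rho> q"
    by (simp add: lin_ext_superset[symmetric])
  finally show ?thesis .
qed

lemma lin_ext_single: "lin_ext \<rho> (single m c) = single 0 c * \<rho> m"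
  by (simp add: lin_ext_def)

lemma lin_ext_zero [simp]: "lin_ext \<rho> 0 = 0"
  by (simp add: lin_ext_def)

lemma lin_ext_sum: "lin_ext \<rho> (sum f A) = (\<Sum>a\<in>A. lin_ext \<rho> (f a))"
  by (induction A rule: infinite_finite_induct) (simp_all add: lin_ext_add)

lemma lin_ext_scale: "lin_ext \<rho> (single 0 c * p) = single 0 c * lin_ext \<rho> p"
  by (induction p rule: mpoly_induct)
    (simp_all add: lin_ext_add lin_ext_single mult_single distrib_left mult.assoc[symmetric])

definition mon_eval :: "('v \<Rightarrow> 'r::comm_semiring_1) \<Rightarrow> ('v \<Rightarrow>\<^sub>0 nat) \<Rightarrow> 'r" where
  "mon_eval F m = (\<Prod>v\<in>keys m. F v ^ lookup m v)"

lemma mon_eval_superset: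
  "finite A \<Longrightarrow> keys m \<subseteq> A \<Longrightarrow> mon_eval F m = (\<Prod>v\<in>A. F v ^ lookup m v)"
  unfolding mon_eval_def by (rule prod.mono_neutral_left) (auto simp: in_keys_iff)

lemma mon_eval_add: "mon_eval F (m + n) = mon_eval F m * mon_eval F n"
proof -
  let ?A = "keys m \<union> keys n"
  have "mon_eval F (m + n) = (\<Prod>v\<in>?A. F v ^ lookup (m + n) v)"
    by (rule mon_eval_superset) (auto simp: keys_add)
  also have "\<dots> = (\<Prod>v\<in>?A. F v ^ lookup m v) * (\<Prod>v\<in>?A. F v ^ lookup n v)"
    by (simp add: lookup_add power_add prod.distrib)
  also have "\<dots> = mon_eval F m * mon_eval F n"
    by (simp add: mon_eval_superset[symmetric])
  finally show ?thesis .
qed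

lemma mon_eval_zero [simp]: "mon_eval F 0 = 1"
  by (simp add: mon_eval_def)

lemma mon_eval_mult: "mon_eval (\<lambda>v. F v * G v) m = mon_eval F m * mon_eval G m"
  by (simp add: mon_eval_def power_mult_distrib prod.distrib)


lemma mon_eval_var: "mon_eval var m = single m (1::'k::field)"
proof -
  have pw: "var v ^ n = single (single v n) (1::'k)" for n and v :: 'a
  proof (induction n)
    case (Suc n)
    then show ?case
      by (simp add: var_def mult_single single_add[symmetric])
  qed simp
  have "(\<Prod>v\<in>A. single (single v (lookup m v)) (1::'k)) = single (\<Sum>v\<in>A. single v (lookup m v)) 1"
    for A
    by (induction A rule: infinite_finite_induct) (simp_all add: mult_single)
  then show ?thesis
    unfolding mon_eval_def pw using poly_mapping_sum_singles[of m] by simp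
qed

definition poly_subst :: "('v \<Rightarrow> ('w, 'k::field) mpoly) \<Rightarrow> ('v, 'k) mpoly \<Rightarrow> ('w, 'k) mpoly" where
  "poly_subst F = lin_ext (mon_eval F)"

lemma poly_subst_add [simp]: "poly_subst F (p + q) = poly_subst F p + poly_subst F q"
  by (simp add: poly_subst_def lin_ext_add)

lemma poly_subst_zero [simp]: "poly_subst F 0 = 0"
  by (simp add: poly_subst_def)

lemma poly_subst_single: "poly_subst F (single m c) = single 0 c * mon_eval F m"
  by (simp add: poly_subst_def lin_ext_single)

lemma poly_subst_const [simp]: "poly_subst F (single 0 c) = single 0 c"
  by (simp add: poly_subst_single)

lemma poly_subst_one [simp]: "poly_subst F 1 = 1"
  using poly_subst_const[of F 1] by simp

lemma poly_subst_uminus [simp]: "poly_subst F (- p) = - poly_subst F p"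
  using poly_subst_add[of F p "- p"] by (simp add: eq_neg_iff_add_eq_0 add.commute)

lemma poly_subst_diff [simp]: "poly_subst F (p - q) = poly_subst F p - poly_subst F q"
  using poly_subst_add[of F p "- q"] by simp

lemma poly_subst_mult [simp]:
  fixes F :: "'v \<Rightarrow> ('w, 'k::field) mpoly"
  shows "poly_subst F (p * q) = poly_subst F p * poly_subst F q"
proof (induction p rule: mpoly_induct)
  case (single m c)
  show ?case
  proof (induction q rule: mpoly_induct)
    case (single n d)
    have "poly_subst F (single m c * single n d) = single 0 (c * d) * mon_eval F (m + n)"
      by (simp add: mult_single poly_subst_single)
    also have "\<dots> = (single 0 c * single 0 d) * (mon_eval F m * mon_eval F n)"
      by (simp add: mult_single mon_eval_add)
    also have "\<dots> = (single 0 c * mon_eval F m) * (single 0 d * mon_eval F n)"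
      by (simp only: ac_simps)
    finally show ?case by (simp add: poly_subst_single)
  qed (simp add: distrib_left)
qed (simp add: distrib_right)

lemma poly_subst_power [simp]: "poly_subst F (p ^ n) = poly_subst F p ^ n"
  by (induction n) simp_all

lemma poly_subst_prod: "poly_subst F (prod f A) = (\<Prod>a\<in>A. poly_subst F (f a))"
  by (induction A rule: infinite_finite_induct) simp_all

lemma poly_subst_mon_eval: "poly_subst G (mon_eval F m) = mon_eval (\<lambda>v. poly_subst G (F v)) m"
  by (simp add: mon_eval_def poly_subst_prod)

lemma poly_subst_subst: "poly_subst G (poly_subst F p) = poly_subst (\<lambda>v. poly_subst G (F v)) p"
  by (induction p rule: mpoly_induct) (simp_all add: poly_subst_single poly_subst_mon_eval)

lemma poly_subst_var [simp]: "poly_subst F (var v) = F v"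
  by (simp add: var_def poly_subst_single mon_eval_def)

lemma poly_subst_id: "poly_subst var p = p"
  by (induction p rule: mpoly_induct) (simp_all add: poly_subst_single mon_eval_var mult_single)

definition polys_in :: "'v set \<Rightarrow> ('v, 'k::field) mpoly set" where
  "polys_in V = {p. \<forall>m\<in>keys p. keys m \<subseteq> V}"

lemma poly_subst_cong:
  assumes "p \<in> polys_in V" "\<And>v. v \<in> V \<Longrightarrow> F v = G v"
  shows "poly_subst F p = poly_subst G p"
proof -
  have "mon_eval F m = mon_eval G m" if "m \<in> keys p" for m
    unfolding mon_eval_def
  proof (rule prod.cong)
    fix v assume "v \<in> keys m"
    then have "v \<in> V" using assms(1) that by (auto simp: polys_in_def)
    then show "F v ^ lookup m v = G v ^ lookup m v" by (simp add: assms(2))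
  qed simp
  then show ?thesis by (simp add: poly_subst_def lin_ext_def)
qed

text \<open>
  That a product of nonzero polynomials is nonzero is seen on leading monomials, so it requires an
  order on the variables. Only finitely many variables occur, and an injective renaming to natural
  numbers, undone by the inverse renaming, provides one.
\<close>

lemma mpoly_no_zero_divisors:
  fixes p q :: "('v, 'k::field) mpoly"
  assumes "p * q = 0"
  shows "p = 0 \<or> q = 0"
proof -
  define V where "V = (\<Union>m\<in>keys p \<union> keys q. keys m)"
  have "finite V" by (simp add: V_def)
  from finite_imp_inj_to_nat_seg[OF this] obtain e :: "'v \<Rightarrow> nat" where e: "inj_on e V"
    by auto
  let ?E = "\<lambda>v. var (e v) :: (nat, 'k) mpoly"
  have inv: "poly_subst (\<lambda>n. var (inv_into V e n)) (poly_subst ?E r) = r" if "r \<in> polys_in V" for r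
  proof -
    have "poly_subst (\<lambda>n. var (inv_into V e n)) (poly_subst ?E r) = poly_subst var r"
      unfolding poly_subst_subst using that by (rule poly_subst_cong) (simp add: inv_into_f_f[OF e])
    then show ?thesis by (simp add: poly_subst_id)
  qed
  have "poly_subst ?E p * poly_subst ?E q = 0"
    using assms poly_subst_mult[of ?E p q] by simp
  then have "poly_subst ?E p = 0 \<or> poly_subst ?E q = 0"
    by simp
  moreover have "p \<in> polys_in V" "q \<in> polys_in V"
    unfolding V_def polys_in_def by blast+
  then have "poly_subst ?E p = 0 \<Longrightarrow> p = 0" "poly_subst ?E q = 0 \<Longrightarrow> q = 0"
    using inv[of p] inv[of q] by simp_all
  ultimately show ?thesis by blast
qed

section \<open>Prime ideals of polynomial rings\<close>

definition is_prime :: "'v set \<Rightarrow> ('v, 'k::field) mpoly set \<Rightarrow> bool" where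
  "is_prime V P \<longleftrightarrow> primeideal P (mpoly_ring V)"

lemma mpoly_ring_simps:
  "carrier (mpoly_ring V) = polys_in V" "monoid.mult (mpoly_ring V) = (*)"
  "monoid.one (mpoly_ring V) = 1" "ring.zero (mpoly_ring V) = 0" "ring.add (mpoly_ring V) = (+)"
  by (simp_all add: mpoly_ring_def polys_in_def)

lemma polys_in_intros:
  fixes p q :: "('v, 'k::field) mpoly"
  shows
  "0 \<in> polys_in V" "1 \<in> polys_in V" "single 0 c \<in> polys_in V"
  "p \<in> polys_in V \<Longrightarrow> q \<in> polys_in V \<Longrightarrow> p + q \<in> polys_in V"
  "p \<in> polys_in V \<Longrightarrow> q \<in> polys_in V \<Longrightarrow> p * q \<in> polys_in V"
  "p \<in> polys_in V \<Longrightarrow> - p \<in> polys_in V"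
  "keys m \<subseteq> V \<Longrightarrow> single m c \<in> polys_in V"
  "v \<in> V \<Longrightarrow> var v \<in> polys_in V"
proof -
  interpret cring "mpoly_ring V :: ('v, 'k) mpoly ring" by (rule cring_mpoly_ring)
  show "p \<in> polys_in V \<Longrightarrow> q \<in> polys_in V \<Longrightarrow> p + q \<in> polys_in V"
    "p \<in> polys_in V \<Longrightarrow> q \<in> polys_in V \<Longrightarrow> p * q \<in> polys_in V"
    using a_closed[of p q] m_closed[of p q] by (simp_all add: mpoly_ring_simps)
qed (auto simp: polys_in_def var_def split: if_splits)

lemma polys_in_diff: "p \<in> polys_in V \<Longrightarrow> q \<in> polys_in V \<Longrightarrow> p - q \<in> polys_in V"
  using polys_in_intros(4)[of p V "- q"] polys_in_intros(6)[of q V] by simp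

lemma is_primeD:
  assumes "is_prime V P"
  shows "P \<subseteq> polys_in V" "0 \<in> P" "1 \<notin> P"
    "p \<in> P \<Longrightarrow> q \<in> P \<Longrightarrow> p + q \<in> P" "p \<in> P \<Longrightarrow> q \<in> P \<Longrightarrow> p - q \<in> P"
    "p \<in> P \<Longrightarrow> r \<in> polys_in V \<Longrightarrow> r * p \<in> P" "p \<in> P \<Longrightarrow> r \<in> polys_in V \<Longrightarrow> p * r \<in> P"
    "p \<in> polys_in V \<Longrightarrow> q \<in> polys_in V \<Longrightarrow> p * q \<in> P \<Longrightarrow> p \<in> P \<or> q \<in> P"
proof -
  interpret primeideal P "mpoly_ring V" using assms by (simp add: is_prime_def)
  show sub: "P \<subseteq> polys_in V" using a_subset by (simp add: mpoly_ring_simps)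
  show "0 \<in> P" using additive_subgroup.zero_closed[OF additive_subgroup_axioms] by (simp add: mpoly_ring_simps)
  show "1 \<notin> P" using one_imp_carrier I_notcarr unfolding mpoly_ring_simps by metis
  show add: "p \<in> P \<Longrightarrow> q \<in> P \<Longrightarrow> p + q \<in> P" for p q
    using additive_subgroup.a_closed[OF additive_subgroup_axioms, of p q] by (simp add: mpoly_ring_simps)
  show l: "p \<in> P \<Longrightarrow> r \<in> polys_in V \<Longrightarrow> r * p \<in> P" for p r
    using I_l_closed[of p r] by (simp add: mpoly_ring_simps)
  then show "p \<in> P \<Longrightarrow> r \<in> polys_in V \<Longrightarrow> p * r \<in> P"
    by (simp add: mult.commute)
  show "p \<in> P \<Longrightarrow> q \<in> P \<Longrightarrow> p - q \<in> P"
    using add[of p "(- 1) * q"] l[of q "-1"] by (simp add: polys_in_intros)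
  show "p \<in> polys_in V \<Longrightarrow> q \<in> polys_in V \<Longrightarrow> p * q \<in> P \<Longrightarrow> p \<in> P \<or> q \<in> P"
    using I_prime[of p q] by (simp add: mpoly_ring_simps)
qed

lemma is_prime_sum:
  "is_prime V P \<Longrightarrow> (\<And>a. a \<in> A \<Longrightarrow> f a \<in> P) \<Longrightarrow> sum f A \<in> P"
  by (induction A rule: infinite_finite_induct) (simp_all add: is_primeD)

definition subst_kernel :: "'v set \<Rightarrow> ('v \<Rightarrow> ('w, 'k::field) mpoly) \<Rightarrow> ('v, 'k) mpoly set" where
  "subst_kernel V F = {p \<in> polys_in V. poly_subst F p = 0}"

text \<open>
  All primes constructed below arise in this way: they are kernels of homomorphisms into a
  polynomial ring, which is a domain.
\<close>

lemma is_prime_subst_kernel: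
  fixes F :: "'v \<Rightarrow> ('w, 'k::field) mpoly"
  shows "is_prime V (subst_kernel V F)"
proof -
  let ?R = "mpoly_ring V :: ('v, 'k) mpoly ring" and ?P = "subst_kernel V F"
  interpret cring ?R by (rule cring_mpoly_ring)
  have "subgroup ?P (add_monoid ?R)"
  proof (rule subgroup.intro)
    fix p assume p: "p \<in> ?P"
    have "\<ominus>\<^bsub>?R\<^esub> p = - p"
      using p by (intro minus_equality) (auto simp: mpoly_ring_simps subst_kernel_def polys_in_intros)
    then have "inv\<^bsub>add_monoid ?R\<^esub> p = - p"
      by (simp add: a_inv_def)
    then show "inv\<^bsub>add_monoid ?R\<^esub> p \<in> ?P"
      using p by (simp add: subst_kernel_def polys_in_intros)
  qed (auto simp: subst_kernel_def mpoly_ring_simps polys_in_intros)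
  then have "ideal ?P ?R"
    by (intro idealI ring_axioms)
      (auto simp: subst_kernel_def mpoly_ring_simps polys_in_intros)
  moreover have "carrier ?R \<noteq> ?P"
    using polys_in_intros(2) by (force simp: mpoly_ring_simps subst_kernel_def)
  ultimately show ?thesis
    unfolding is_prime_def
    by (intro primeidealI cring_mpoly_ring)
      (auto simp: subst_kernel_def mpoly_ring_simps dest: mpoly_no_zero_divisors)
qed

section \<open>Chains of primes are no longer than the number of variables\<close>

definition box_monomials :: "'v set \<Rightarrow> nat \<Rightarrow> ('v \<Rightarrow>\<^sub>0 nat) set" where
  "box_monomials V d = {m. keys m \<subseteq> V \<and> (\<forall>v. lookup m v \<le> d)}"

definition box_polys :: "'v set \<Rightarrow> nat \<Rightarrow> ('v, 'k::field) mpoly set" where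
  "box_polys V d = {p. keys p \<subseteq> box_monomials V d}"

definition indep_mod :: "('v, 'k::field) mpoly set \<Rightarrow> ('v, 'k) mpoly set \<Rightarrow> bool" where
  "indep_mod P B \<longleftrightarrow>
     finite B \<and> (\<forall>c. (\<Sum>b\<in>B. single 0 (c b) * b) \<in> P \<longrightarrow> (\<forall>b\<in>B. c b = 0))"

text \<open>
  This is the dimension of the space of polynomials with all exponents at most \<open>d\<close>, modulo \<open>P\<close>: a
  Hilbert function for the filtration by the largest exponent. Its value for the zero ideal is \<open>(d + 1)\<^sup>n\<close>,
  where \<open>n\<close> is the number of variables, so growth orders can be compared by powers of \<open>d + 1\<close> alone.
\<close>

definition box_rank :: "'v set \<Rightarrow> ('v, 'k::field) mpoly set \<Rightarrow> nat \<Rightarrow> nat" where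
  "box_rank V P d = Max (card ` {B. B \<subseteq> box_polys V d \<and> indep_mod P B})"

lemma finite_box_monomials:
  assumes "finite V"
  shows "finite (box_monomials V d)" and "card (box_monomials V d) \<le> Suc d ^ card V"
proof -
  let ?r = "\<lambda>m. restrict (lookup m) V"
  have inj: "inj_on ?r (box_monomials V d)"
  proof (rule inj_onI)
    fix m n assume mn: "m \<in> box_monomials V d" "n \<in> box_monomials V d" and eq: "?r m = ?r n"
    show "m = n"
    proof (rule poly_mapping_eqI)
      fix v
      show "lookup m v = lookup n v"
      proof (cases "v \<in> V")
        case True
        then show ?thesis using fun_cong[OF eq, of v] by simp
      next
        case False
        then have "v \<notin> keys m" "v \<notin> keys n" using mn by (auto simp: box_monomials_def)
        then show ?thesis by (simp add: in_keys_iff)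
      qed
    qed
  qed
  have sub: "?r ` box_monomials V d \<subseteq> (\<Pi>\<^sub>E v\<in>V. {..d})"
    by (auto simp: box_monomials_def)
  have fin: "finite (\<Pi>\<^sub>E v\<in>V. {..d})"
    using assms by (simp add: finite_PiE)
  show "finite (box_monomials V d)"
    using finite_imageD[OF finite_subset[OF sub fin] inj] .
  show "card (box_monomials V d) \<le> Suc d ^ card V"
    using card_inj_on_le[OF inj sub fin] by (simp add: card_PiE assms)
qed

lemma card_indep_mod_le:
  fixes P :: "('v, 'k::field) mpoly set"
  assumes V: "finite V" and P: "0 \<in> P" and B: "B \<subseteq> box_polys V d" "indep_mod P B"
  shows "card B \<le> Suc d ^ card V"
proof -
  interpret vector_space "\<lambda>c p. single 0 c * p :: ('v, 'k) mpoly"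
    by unfold_locales (simp_all add: distrib_left distrib_right single_add mult_single mult.assoc[symmetric])
  let ?M = "(\<lambda>m. single m (1::'k)) ` box_monomials V d"
  have "independent B"
    using B(2) P unfolding indep_mod_def by (intro independent_if_scalars_zero) auto
  moreover have "B \<subseteq> span ?M"
  proof
    fix b assume "b \<in> B"
    then have "keys b \<subseteq> box_monomials V d" using B(1) by (auto simp: box_polys_def)
    then have "(\<Sum>m\<in>keys b. single 0 (lookup b m) * single m 1) \<in> span ?M"
      by (intro span_sum span_scale span_base) auto
    then show "b \<in> span ?M"
      using poly_mapping_sum_singles[of b] by (simp add: mult_single)
  qed
  ultimately have "card B \<le> card ?M"
    using independent_span_bound finite_box_monomials[OF V] by blast
  also have "\<dots> \<le> card (box_monomials V d)"
    by (rule card_image_le) (rule finite_box_monomials[OF V])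
  also have "\<dots> \<le> Suc d ^ card V"
    by (rule finite_box_monomials[OF V])
  finally show ?thesis .
qed

context
  fixes V :: "'v set" and P :: "('v, 'k::field) mpoly set"
  assumes V: "finite V" and P: "is_prime V P"
begin

private lemma finite_cards: "finite (card ` {B. B \<subseteq> box_polys V d \<and> indep_mod P B})"
  by (rule finite_subset[of _ "{..Suc d ^ card V}"]) (auto intro: card_indep_mod_le[OF V is_primeD(2)[OF P]])

private lemma empty_indep: "{} \<subseteq> box_polys V d \<and> indep_mod P {}"
  by (simp add: indep_mod_def)

lemma box_rank_ge: "B \<subseteq> box_polys V d \<Longrightarrow> indep_mod P B \<Longrightarrow> card B \<le> box_rank V P d"
  unfolding box_rank_def by (intro Max_ge finite_cards) auto

lemma box_rank_attained: "\<exists>B. B \<subseteq> box_polys V d \<and> indep_mod P B \<and> card B = box_rank V P d"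
proof -
  have "box_rank V P d \<in> card ` {B. B \<subseteq> box_polys V d \<and> indep_mod P B}"
    unfolding box_rank_def using empty_indep by (intro Max_in finite_cards) blast
  then show ?thesis by auto
qed

lemma box_rank_le: "box_rank V P d \<le> Suc d ^ card V"
  using box_rank_attained[of d] card_indep_mod_le[OF V is_primeD(2)[OF P]] by metis

lemma box_rank_mono: "d \<le> e \<Longrightarrow> box_rank V P d \<le> box_rank V P e"
proof -
  assume "d \<le> e"
  then have "box_polys V d \<subseteq> (box_polys V e :: ('v, 'k) mpoly set)"
    unfolding box_polys_def box_monomials_def using le_trans by blast
  then show ?thesis
    using box_rank_attained[of d] box_rank_ge[of _ e] by (metis subset_trans)
qed

lemma box_rank_pos: "0 < box_rank V P d"
proof -
  have "indep_mod P {1}"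
  proof -
    have "c = 0" if "single 0 c \<in> P" for c
    proof (rule ccontr)
      assume "c \<noteq> 0"
      then have "single 0 (inverse c) * single 0 c = (1 :: ('v, 'k) mpoly)"
        by (simp add: mult_single)
      then show False
        using is_primeD(6)[OF P that, of "single 0 (inverse c)"] is_primeD(3)[OF P]
        by (simp add: polys_in_intros)
    qed
    then show ?thesis by (auto simp: indep_mod_def)
  qed
  moreover have "{1} \<subseteq> (box_polys V d :: ('v, 'k) mpoly set)"
    by (simp add: box_polys_def box_monomials_def)
  ultimately show ?thesis
    using box_rank_ge[of "{1}" d] by simp
qed

end

lemma box_polys_in: "p \<in> box_polys V d \<Longrightarrow> p \<in> polys_in V"
  by (auto simp: box_polys_def box_monomials_def polys_in_def)

lemma box_polys_mult:
  assumes "p \<in> box_polys V d" "q \<in> box_polys V e"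
  shows "p * q \<in> box_polys V (d + e)"
  unfolding box_polys_def
proof (rule CollectI, rule subsetI)
  fix m assume "m \<in> keys (p * q)"
  then obtain a b where m: "m = a + b" and ab: "a \<in> keys p" "b \<in> keys q"
    using keys_mult[of p q] by blast
  then have "a \<in> box_monomials V d" "b \<in> box_monomials V e"
    using assms by (auto simp: box_polys_def)
  then show "m \<in> box_monomials V (d + e)"
    using keys_add[of a b] unfolding m by (auto simp: box_monomials_def lookup_add intro: add_mono)
qed

lemma box_polys_exists:
  assumes "p \<in> polys_in V"
  shows "\<exists>d. p \<in> box_polys V d"
proof -
  let ?L = "\<Union>m\<in>keys p. lookup m ` keys m"
  have fin: "finite ?L" by simp
  have "lookup m v \<le> Max (insert 0 ?L)" if "m \<in> keys p" for m v
  proof (cases "v \<in> keys m")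
    case True
    then have "lookup m v \<in> insert 0 ?L" using that by blast
    then show ?thesis using fin by (intro Max_ge) auto
  qed (simp add: in_keys_iff)
  then have "p \<in> box_polys V (Max (insert 0 ?L))"
    using assms by (auto simp: box_polys_def box_monomials_def polys_in_def)
  then show ?thesis ..
qed

text \<open>
  Multiplication by \<open>f \<in> Q - P\<close> embeds \<open>R/P\<close> into the kernel \<open>Q/P\<close> of \<open>R/P \<rightarrow> R/Q\<close>. So a family that is
  independent modulo \<open>Q\<close> and the \<open>f\<close>-multiples of a family that is independent modulo \<open>P\<close> are
  together independent modulo \<open>P\<close>.
\<close>

lemma box_rank_drop_step:
  fixes P Q :: "('v, 'k::field) mpoly set"
  assumes V: "finite V" and P: "is_prime V P" and Q: "is_prime V Q" and sub: "P \<subseteq> Q"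
    and f: "f \<in> Q" "f \<notin> P" "f \<in> box_polys V e"
  shows "box_rank V Q (d + e) + box_rank V P d \<le> box_rank V P (d + e)"
proof -
  obtain B1 where B1: "B1 \<subseteq> box_polys V (d + e)" "indep_mod Q B1" "card B1 = box_rank V Q (d + e)"
    using box_rank_attained[OF V Q] by blast
  obtain B2 where B2: "B2 \<subseteq> box_polys V d" "indep_mod P B2" "card B2 = box_rank V P d"
    using box_rank_attained[OF V P] by blast
  have fin: "finite B1" "finite B2" using B1(2) B2(2) by (auto simp: indep_mod_def)
  have lin: "\<And>c. (\<Sum>b\<in>B1. single 0 (c b) * b) \<in> Q \<Longrightarrow> \<forall>b\<in>B1. c b = 0"
    "\<And>c. (\<Sum>b\<in>B2. single 0 (c b) * b) \<in> P \<Longrightarrow> \<forall>b\<in>B2. c b = 0"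
    using B1(2) B2(2) by (auto simp: indep_mod_def)
  have fV: "f \<in> polys_in V" using f(3) by (rule box_polys_in)
  have B2V: "B2 \<subseteq> polys_in V" using B2(1) box_polys_in by blast
  have cancel: "g \<in> P" if "f * g \<in> P" "g \<in> polys_in V" for g
    using is_primeD(8)[OF P fV that(2,1)] f(2) by simp
  have inj: "inj_on ((*) f) B2"
  proof (rule inj_onI, rule ccontr)
    fix a b assume ab: "a \<in> B2" "b \<in> B2" "f * a = f * b" "a \<noteq> b"
    then have "f * (a - b) \<in> P" by (simp add: right_diff_distrib is_primeD(2)[OF P])
    moreover have "a - b \<in> polys_in V" using ab B2V by (intro polys_in_diff) auto
    ultimately have "a - b \<in> P" by (rule cancel)
    moreover have "(\<Sum>x\<in>B2. single 0 (if x = a then 1 else if x = b then -1 else 0) * x) = a - b"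
    proof -
      have "(\<Sum>x\<in>B2. single 0 (if x = a then 1 else if x = b then -1 else 0) * x)
          = (\<Sum>x\<in>B2. (if x = a then a else 0) + (if x = b then - b else 0))"
        using ab(4) by (intro sum.cong) (auto simp: single_uminus)
      also have "\<dots> = a - b" using ab fin by (simp add: sum.distrib)
      finally show ?thesis .
    qed
    ultimately have "\<forall>x\<in>B2. (if x = a then 1 else if x = b then -1 else 0) = (0::'k)"
      by (intro lin(2)) simp
    then show False using ab(1) by fastforce
  qed
  have disj: "B1 \<inter> (*) f ` B2 = {}"
  proof (rule ccontr)
    assume "B1 \<inter> (*) f ` B2 \<noteq> {}"
    then obtain b where b: "b \<in> B2" "f * b \<in> B1" by blast
    have "(\<Sum>x\<in>B1. single 0 (if x = f * b then 1 else 0) * x) = (\<Sum>x\<in>B1. if x = f * b then x else 0)"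
      by (intro sum.cong) auto
    also have "\<dots> = f * b" using b fin by simp
    also have "\<dots> \<in> Q" using is_primeD(7)[OF Q f(1)] B2V b by blast
    finally have "\<forall>x\<in>B1. (if x = f * b then 1 else 0) = (0::'k)" by (rule lin(1))
    then show False using b(2) by fastforce
  qed
  have "indep_mod P (B1 \<union> (*) f ` B2)"
    unfolding indep_mod_def
  proof (intro conjI allI impI)
    fix c assume c: "(\<Sum>b\<in>B1 \<union> (*) f ` B2. single 0 (c b) * b) \<in> P"
    let ?s1 = "\<Sum>b\<in>B1. single 0 (c b) * b" and ?s2 = "\<Sum>b\<in>B2. single 0 (c (f * b)) * b"
    have "(\<Sum>b\<in>(*) f ` B2. single 0 (c b) * b) = f * ?s2"
      unfolding sum.reindex[OF inj] sum_distrib_left by (intro sum.cong) (simp_all add: ac_simps)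
    then have split: "(\<Sum>b\<in>B1 \<union> (*) f ` B2. single 0 (c b) * b) = ?s1 + f * ?s2"
      using fin disj by (simp add: sum.union_disjoint)
    have s2: "?s2 \<in> polys_in V"
      using B2V by (induction B2 rule: infinite_finite_induct) (auto simp: polys_in_intros)
    have "?s1 + f * ?s2 \<in> Q" using c split sub by auto
    then have "?s1 + f * ?s2 - f * ?s2 \<in> Q"
      using is_primeD(7)[OF Q f(1) s2] by (rule is_primeD(5)[OF Q])
    then have c1: "\<forall>b\<in>B1. c b = 0" by (intro lin(1)) simp
    then have "?s1 = 0" by simp
    then have "f * ?s2 \<in> P" using c split by simp
    then have "?s2 \<in> P" using s2 by (rule cancel)
    then have "\<forall>b\<in>B2. c (f * b) = 0" by (rule lin(2))
    then show "\<forall>b\<in>B1 \<union> (*) f ` B2. c b = 0" using c1 by blast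
  qed (use fin in auto)
  moreover have "B1 \<union> (*) f ` B2 \<subseteq> box_polys V (d + e)"
    using B1(1) B2(1) box_polys_mult[OF f(3), of _ d] by (auto simp: add.commute)
  ultimately have "card (B1 \<union> (*) f ` B2) \<le> box_rank V P (d + e)"
    by (intro box_rank_ge V P)
  then show ?thesis
    using fin disj inj B1(3) B2(3) by (simp add: card_Un_disjoint card_image)
qed

text \<open>
  Summing the preceding inequality over \<open>d + 1\<close> steps of length \<open>e\<close> turns it into a comparison of
  growth orders: up to rescaling the argument, the rank modulo \<open>Q\<close> is smaller by a factor \<open>d + 1\<close>.
\<close>

lemma box_rank_drop:
  fixes P Q :: "('v, 'k::field) mpoly set"
  assumes V: "finite V" and P: "is_prime V P" and Q: "is_prime V Q" and sub: "P \<subset> Q"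
  shows "\<exists>e. \<forall>d. Suc d * box_rank V Q d \<le> box_rank V P (d + Suc d * e)"
proof -
  obtain f where f: "f \<in> Q" "f \<notin> P" using sub by blast
  then obtain e where e: "f \<in> box_polys V e"
    using box_polys_exists is_primeD(1)[OF Q] by blast
  have "k * box_rank V Q d \<le> box_rank V P (d + k * e)" for k d
  proof (induction k)
    case (Suc k)
    have "box_rank V Q d + k * box_rank V Q d
        \<le> box_rank V Q (d + k * e + e) + box_rank V P (d + k * e)"
      by (intro add_mono Suc box_rank_mono V Q) simp
    also have "\<dots> \<le> box_rank V P (d + k * e + e)"
      using sub by (intro box_rank_drop_step[OF V P Q _ f e]) auto
    finally show ?case by (simp add: ac_simps)
  qed simp
  then show ?thesis by blast
qed

definition has_chain :: "'v set \<Rightarrow> ('v, 'k::field) mpoly set \<Rightarrow> nat \<Rightarrow> bool" where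
  "has_chain V P n \<longleftrightarrow> (\<exists>c. (\<forall>i\<le>n. is_prime V (c i)) \<and> (\<forall>i<n. c i \<subset> c (Suc i)) \<and> c n = P)"

lemma has_chain_0: "is_prime V P \<Longrightarrow> has_chain V P 0"
  by (auto simp: has_chain_def)

lemma has_chain_step:
  assumes "has_chain V P n" "is_prime V Q" "P \<subset> Q"
  shows "has_chain V Q (Suc n)"
proof -
  obtain c where c: "\<forall>i\<le>n. is_prime V (c i)" "\<forall>i<n. c i \<subset> c (Suc i)" "c n = P"
    using assms(1) by (auto simp: has_chain_def)
  show ?thesis
    unfolding has_chain_def
    by (rule exI[of _ "c(Suc n := Q)"]) (use c assms in \<open>auto simp: le_Suc_eq less_Suc_eq\<close>)
qed

text \<open>
  Each step of a chain of primes lowers the growth order by one, starting from the order \<open>card V\<close> of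
  the whole ring.
\<close>

lemma chain_growth_bound:
  fixes c :: "nat \<Rightarrow> ('v, 'k::field) mpoly set"
  assumes V: "finite V" and c: "\<forall>i\<le>n. is_prime V (c i)" "\<forall>i<n. c i \<subset> c (Suc i)" and "i \<le> n"
  shows "\<exists>C. \<forall>d. Suc d ^ i * box_rank V (c i) d \<le> C * Suc d ^ card V"
  using \<open>i \<le> n\<close>
proof (induction i)
  case 0
  then show ?case using box_rank_le[OF V] c(1) by (intro exI[of _ 1]) auto
next
  case (Suc i)
  then have "i \<le> n" by simp
  from Suc.IH[OF this] obtain C where C: "\<And>d. Suc d ^ i * box_rank V (c i) d \<le> C * Suc d ^ card V"
    by blast
  obtain e where e: "\<And>d. Suc d * box_rank V (c (Suc i)) d \<le> box_rank V (c i) (d + Suc d * e)"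
    using box_rank_drop[OF V, of "c i" "c (Suc i)"] c Suc.prems by auto
  have "Suc d ^ Suc i * box_rank V (c (Suc i)) d \<le> (C * Suc e ^ card V) * Suc d ^ card V" for d
  proof -
    have eq: "Suc (d + Suc d * e) = Suc d * Suc e" by simp
    have "Suc d ^ Suc i * box_rank V (c (Suc i)) d \<le> Suc d ^ i * box_rank V (c i) (d + Suc d * e)"
      using mult_le_mono2[OF e[of d], of "Suc d ^ i"] by (simp only: power_Suc ac_simps)
    also have "\<dots> \<le> (Suc d * Suc e) ^ i * box_rank V (c i) (d + Suc d * e)"
      by (intro mult_le_mono1 power_mono) auto
    also have "\<dots> \<le> C * (Suc d * Suc e) ^ card V"
      using C[of "d + Suc d * e"] by (simp only: eq)
    finally show ?thesis by (simp only: power_mult_distrib ac_simps)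
  qed
  then show ?case by blast
qed

text \<open>
  The rank modulo the last prime of the chain is still positive, so the growth order cannot have
  been lowered more than \<open>card V\<close> times.
\<close>

lemma has_chain_le:
  fixes P :: "('v, 'k::field) mpoly set"
  assumes V: "finite V" and "has_chain V P n"
  shows "n \<le> card V"
proof (rule ccontr)
  assume n: "\<not> n \<le> card V"
  obtain c where c: "\<forall>i\<le>n. is_prime V (c i)" "\<forall>i<n. c i \<subset> c (Suc i)" "c n = P"
    using assms(2) by (auto simp: has_chain_def)
  from chain_growth_bound[OF V c(1,2) order_refl]
  obtain C where C: "\<And>d. Suc d ^ n * box_rank V P d \<le> C * Suc d ^ card V"
    unfolding c(3) by blast
  have "0 < box_rank V P C" using box_rank_pos[OF V] c by auto
  then have "Suc C ^ n \<le> Suc C ^ n * box_rank V P C" by simp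
  also have "\<dots> \<le> C * Suc C ^ card V" by (rule C)
  also have "\<dots> < Suc C ^ Suc (card V)" by simp
  also have "\<dots> \<le> Suc C ^ n" using n by (intro power_increasing) auto
  finally show False by simp
qed

lemma prime_height_eqI:
  assumes "has_chain V P h" "\<And>n. has_chain V P n \<Longrightarrow> n \<le> h"
  shows "prime_height (mpoly_ring V) P = enat h"
proof -
  have eq: "prime_height (mpoly_ring V) P = Sup {enat n |n. has_chain V P n}"
    by (simp add: prime_height_def has_chain_def is_prime_def)
  show ?thesis
    unfolding eq by (rule antisym) (use assms in \<open>auto intro: Sup_upper Sup_least\<close>)
qed

section \<open>Segre primes\<close>

lemma subst_kernel_mono:
  assumes "\<And>v. v \<in> V \<Longrightarrow> poly_subst G (F v) = F' v"
  shows "subst_kernel V F \<subseteq> subst_kernel V F'"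
proof
  fix p assume p: "p \<in> subst_kernel V F"
  then have "poly_subst F' p = poly_subst (\<lambda>v. poly_subst G (F v)) p"
    by (intro poly_subst_cong[of p V]) (auto simp: subst_kernel_def assms)
  also have "\<dots> = poly_subst G (poly_subst F p)" by (simp add: poly_subst_subst)
  also have "\<dots> = 0" using p by (simp add: subst_kernel_def)
  finally show "p \<in> subst_kernel V F'" using p by (simp add: subst_kernel_def)
qed

lemma var_nonzero [simp]: "var v \<noteq> (0 :: ('v, 'k::field) mpoly)"
  by (metis keys_single keys_zero insert_not_empty var_def zero_neq_one)

lemma mpoly_mult_eq_0_iff [simp]: "p * q = 0 \<longleftrightarrow> p = 0 \<or> q = (0 :: ('v, 'k::field) mpoly)"
  using mpoly_no_zero_divisors[of p q] by auto

text \<open>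
  The pairs \<open>(x\<^sub>i, y\<^sub>i)\<close> are the columns of a matrix with two rows. The substitution below is the
  Segre parametrisation of the matrices in which the columns \<open>i\<close> and \<open>j\<close> with \<open>r i = r j\<close> are
  proportional: column \<open>i\<close> is the direction \<open>(Fst (r i), Snd (r i))\<close> of its class, multiplied by the
  scale of \<open>i\<close>. The entries in \<open>Z\<close> are set to zero. It maps a monomial to a monomial or to zero.
\<close>

datatype 'a segre_var = Fst 'a | Snd 'a | Scale 'a

definition segre_map :: "'a xyvar set \<Rightarrow> ('a \<Rightarrow> 'a) \<Rightarrow> 'a xyvar \<Rightarrow> ('a segre_var, 'k::field) mpoly" where
  "segre_map Z r v = (if v \<in> Z then 0 else
     case v of XV i \<Rightarrow> var (Fst (r i)) * var (Scale i) | YV i \<Rightarrow> var (Snd (r i)) * var (Scale i))"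

definition xy :: "'a set \<Rightarrow> 'a xyvar set" where
  "xy S = XV ` S \<union> YV ` S"

lemma xy_iff [simp]: "XV i \<in> xy S \<longleftrightarrow> i \<in> S" "YV i \<in> xy S \<longleftrightarrow> i \<in> S"
  by (auto simp: xy_def)

definition segre_prime :: "'a set \<Rightarrow> 'a xyvar set \<Rightarrow> ('a \<Rightarrow> 'a) \<Rightarrow> ('a xyvar, 'k::field) mpoly set" where
  "segre_prime U Z r = subst_kernel (xy U) (segre_map Z r)"

definition minor :: "'a \<Rightarrow> 'a \<Rightarrow> ('a xyvar, 'k::field) mpoly" where
  "minor i j = var (XV i) * var (YV j) - var (XV j) * var (YV i)"

lemma is_prime_segre_prime: "is_prime (xy U) (segre_prime U Z r)"
  unfolding segre_prime_def by (rule is_prime_subst_kernel)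

text \<open>
  The parametrisation for \<open>(Z', r')\<close> is a specialisation of the one for \<open>(Z, r)\<close>: identify directions
  of classes that are merged, put the scale of a column to zero if both of its entries vanish, and
  put a coordinate of a direction to zero if it vanishes in the remaining columns of the class. The
  hypothesis says that these prescriptions do not depend on the column chosen in the class.
\<close>

lemma segre_prime_mono:
  assumes Z: "Z \<subseteq> Z'"
    and r: "\<And>i j. i \<in> U \<Longrightarrow> j \<in> U \<Longrightarrow> \<not> (XV i \<in> Z' \<and> YV i \<in> Z') \<Longrightarrow> \<not> (XV j \<in> Z' \<and> YV j \<in> Z') \<Longrightarrow>
      r i = r j \<Longrightarrow> r' i = r' j \<and> (XV i \<in> Z' \<longleftrightarrow> XV j \<in> Z') \<and> (YV i \<in> Z' \<longleftrightarrow> YV j \<in> Z')"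
  shows "segre_prime U Z r \<subseteq> (segre_prime U Z' r' :: ('a xyvar, 'k::field) mpoly set)"
proof -
  let ?alive = "\<lambda>i. i \<in> U \<and> \<not> (XV i \<in> Z' \<and> YV i \<in> Z')"
  \<comment> \<open>\<open>h k\<close> is a column of the class \<open>k\<close> that is not identically zero after the specialisation\<close>
  define h where "h = (\<lambda>k. SOME i. ?alive i \<and> r i = k)"
  define G :: "'a segre_var \<Rightarrow> ('a segre_var, 'k) mpoly" where
    "G v = (case v of
        Fst k \<Rightarrow> if XV (h k) \<in> Z' then 0 else var (Fst (r' (h k)))
      | Snd k \<Rightarrow> if YV (h k) \<in> Z' then 0 else var (Snd (r' (h k)))
      | Scale i \<Rightarrow> if ?alive i then var (Scale i) else 0)" for v
  have h: "?alive (h (r i)) \<and> r (h (r i)) = r i" if "?alive i" for i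
    unfolding h_def using that by (intro someI[of "\<lambda>j. ?alive j \<and> r j = r i" i]) simp
  have h': "r' (h (r i)) = r' i" "XV (h (r i)) \<in> Z' \<longleftrightarrow> XV i \<in> Z'" "YV (h (r i)) \<in> Z' \<longleftrightarrow> YV i \<in> Z'"
    if "?alive i" for i
    using r[of "h (r i)" i] h[OF that] that by auto
  show ?thesis
    unfolding segre_prime_def
  proof (rule subst_kernel_mono[where G = G])
    fix v assume "v \<in> xy U"
    then obtain i where i: "i \<in> U" "v = XV i \<or> v = YV i" by (auto simp: xy_def)
    show "poly_subst G (segre_map Z r v) = segre_map Z' r' v"
    proof (cases "?alive i")
      case True
      then show ?thesis using i(2) Z h'[OF True] by (auto simp: segre_map_def G_def)
    next
      case False
      then show ?thesis using i Z by (auto simp: segre_map_def G_def)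
    qed
  qed
qed

lemma segre_prime_cong:
  assumes "\<And>i. i \<in> U \<Longrightarrow> r i = r' i"
  shows "segre_prime U Z r = segre_prime U Z r'"
  unfolding segre_prime_def
  by (rule antisym; rule subst_kernel_mono[where G = var])
    (use assms in \<open>auto simp: poly_subst_id segre_map_def xy_def\<close>)

lemma var_in_segre_prime: "v \<in> xy U \<Longrightarrow> var v \<in> segre_prime U Z r \<longleftrightarrow> v \<in> Z"
  by (auto simp: segre_prime_def subst_kernel_def segre_map_def polys_in_intros split: xyvar.splits)

lemma minor_polys_in: "i \<in> U \<Longrightarrow> j \<in> U \<Longrightarrow> minor i j \<in> polys_in (xy U)"
  by (auto simp: minor_def intro!: polys_in_diff polys_in_intros)

lemma minor_in_segre_prime:
  assumes "i \<in> U" "j \<in> U" "i \<in> T \<or> j \<in> T \<or> r i = r j"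
  shows "minor i j \<in> segre_prime U (xy T) r"
proof -
  have "poly_subst (segre_map (xy T) r) (minor i j) = 0"
    using assms(3) by (auto simp: minor_def segre_map_def)
  then show ?thesis
    using minor_polys_in[OF assms(1,2)] by (simp add: segre_prime_def subst_kernel_def)
qed

lemma minor_notin_segre_prime:
  assumes "i \<notin> T" "j \<notin> T" "r i \<noteq> r j"
  shows "minor i j \<notin> (segre_prime U (xy T) r :: ('a xyvar, 'k::field) mpoly set)"
proof
  \<comment> \<open>specialise so that only the term \<open>x\<^sub>i y\<^sub>j\<close> survives\<close>
  define G :: "'a segre_var \<Rightarrow> ('a segre_var, 'k) mpoly" where
    "G v = (case v of Fst k \<Rightarrow> if k = r i then 1 else 0 | Snd k \<Rightarrow> if k = r j then 1 else 0 | Scale _ \<Rightarrow> 1)" for v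
  assume "minor i j \<in> (segre_prime U (xy T) r :: ('a xyvar, 'k) mpoly set)"
  then have "poly_subst G (poly_subst (segre_map (xy T) r) (minor i j)) = 0"
    by (simp add: segre_prime_def subst_kernel_def)
  then show False
    using assms by (simp add: minor_def segre_map_def G_def)
qed

section \<open>Heights of the Segre primes\<close>

text \<open>
  A column that does not vanish still has its scale as a free parameter, so setting the column to
  zero is a proper specialisation.
\<close>

lemma chain_kill:
  fixes r :: "'a \<Rightarrow> 'a"
  assumes c: "has_chain (xy U) (segre_prime U (xy S) r :: ('a xyvar, 'k::field) mpoly set) n" and t: "t \<in> U" "t \<notin> S"
  shows "has_chain (xy U) (segre_prime U (xy (insert t S)) r :: ('a xyvar, 'k) mpoly set) (Suc n)"
proof (rule has_chain_step[OF c is_prime_segre_prime])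
  have "segre_prime U (xy S) r \<subseteq> (segre_prime U (xy (insert t S)) r :: ('a xyvar, 'k) mpoly set)"
    by (rule segre_prime_mono) (auto simp: xy_def)
  moreover have "var (XV t) \<in> (segre_prime U (xy (insert t S)) r - segre_prime U (xy S) r :: ('a xyvar, 'k) mpoly set)"
    using t by (simp add: var_in_segre_prime)
  ultimately show "segre_prime U (xy S) r \<subset> (segre_prime U (xy (insert t S)) r :: ('a xyvar, 'k) mpoly set)"
    by blast
qed

text \<open>
  If column \<open>t\<close> is the only nonzero column of its class, then it is a pair of free variables, which
  can be set to zero one after the other.
\<close>

lemma chain_kill_isolated:
  fixes r :: "'a \<Rightarrow> 'a"
  assumes c: "has_chain (xy U) (segre_prime U (xy S) r :: ('a xyvar, 'k::field) mpoly set) n" and t: "t \<in> U" "t \<notin> S"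
    and iso: "\<And>j. j \<in> U \<Longrightarrow> j \<notin> S \<Longrightarrow> r j = r t \<Longrightarrow> j = t"
  shows "has_chain (xy U) (segre_prime U (xy (insert t S)) r :: ('a xyvar, 'k) mpoly set) (Suc (Suc n))"
proof (rule has_chain_step[OF has_chain_step[OF c is_prime_segre_prime] is_prime_segre_prime])
  let ?P = "\<lambda>Z. segre_prime U Z r :: ('a xyvar, 'k) mpoly set"
  let ?Z = "insert (XV t) (xy S)"
  have "?P (xy S) \<subseteq> ?P ?Z"
  proof (rule segre_prime_mono)
    fix i j
    assume ij: "i \<in> U" "j \<in> U" "\<not> (XV i \<in> ?Z \<and> YV i \<in> ?Z)" "\<not> (XV j \<in> ?Z \<and> YV j \<in> ?Z)" "r i = r j"
    then have S: "i \<notin> S" "j \<notin> S" by auto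
    then have "i = t \<longleftrightarrow> j = t" using ij iso[of i] iso[of j] by auto
    then show "r i = r j \<and> (XV i \<in> ?Z) = (XV j \<in> ?Z) \<and> (YV i \<in> ?Z) = (YV j \<in> ?Z)"
      using S ij by simp
  qed auto
  moreover have "var (XV t) \<in> ?P ?Z - ?P (xy S)"
    using t by (simp add: var_in_segre_prime)
  ultimately show "?P (xy S) \<subset> ?P ?Z" by blast
  have "?P ?Z \<subseteq> ?P (xy (insert t S))"
    by (rule segre_prime_mono) (auto simp: xy_def)
  moreover have "var (YV t) \<in> ?P (xy (insert t S)) - ?P ?Z"
    using t by (simp add: var_in_segre_prime)
  ultimately show "?P ?Z \<subset> ?P (xy (insert t S))" by blast
qed

text \<open>
  The prime sits on an explicit chain of primes of length \<open>2 * card U\<close>, the number of variables, which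
  no chain can exceed. Below it, start from generic columns, make every column in \<open>N\<close> proportional
  to the representative of its class, and then set the columns in \<open>T\<close> to zero, which takes two
  steps each; this is a chain of length \<open>card N + 2 * card T\<close>. Above it, set the columns in \<open>N\<close> to
  zero, and then the representatives in \<open>R\<close>, which are then alone in their classes and take two
  steps each. A longer chain below the prime could be continued by this second part to a chain
  that is too long.
\<close>

lemma height_segre_prime:
  fixes U T :: "'a set"
  assumes U: "finite U" and T: "T \<subseteq> U"
    and r: "\<And>i. i \<in> U - T \<Longrightarrow> r i \<in> U - T \<and> r (r i) = r i" and rT: "\<And>i. i \<in> T \<Longrightarrow> r i = i"
  shows "prime_height (mpoly_ring (xy U)) (segre_prime U (xy T) r :: ('a xyvar, 'k::field) mpoly set)
    = enat (card U + card T - card (r ` (U - T)))"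
proof -
  let ?P = "\<lambda>S. segre_prime U (xy S) r :: ('a xyvar, 'k) mpoly set"
  let ?chain = "has_chain (xy U) :: ('a xyvar, 'k) mpoly set \<Rightarrow> nat \<Rightarrow> bool"
  define N where "N = {i \<in> U - T. r i \<noteq> i}"
  define R where "R = {i \<in> U - T. r i = i}"
  have sub: "N \<subseteq> U" "R \<subseteq> U" "N \<inter> T = {}" "R \<inter> T = {}" "R \<inter> N = {}" and U_eq: "U = T \<union> N \<union> R"
    using T by (auto simp: N_def R_def)
  have fin: "finite T" "finite N" "finite R" using U T sub by (auto intro: finite_subset)
  have card_U: "card U = card T + card N + card R"
    unfolding U_eq using fin sub by (subst card_Un_disjoint; (subst card_Un_disjoint)?) auto
  have R: "r ` (U - T) = R"
  proof
    show "r ` (U - T) \<subseteq> R" using r by (auto simp: R_def)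
    show "R \<subseteq> r ` (U - T)" by (force simp: R_def)
  qed
  have merge: "?chain (segre_prime U {} (\<lambda>i. if i \<in> M then r i else i)) (card M)" if "finite M" "M \<subseteq> N" for M
    using that
  proof (induction M rule: finite_induct)
    case empty
    show ?case by (simp add: has_chain_0 is_prime_segre_prime)
  next
    case (insert t M)
    let ?r = "\<lambda>M i. if i \<in> M then r i else i"
    have t: "t \<in> U" "t \<in> N" "r t \<in> U" "r t \<noteq> t" "r t \<notin> N"
      using insert.prems r by (auto simp: N_def)
    have M: "t \<noteq> r i" if "i \<in> M" for i
      using that insert.prems r by (auto simp: N_def)
    have "segre_prime U {} (?r M) \<subseteq> (segre_prime U {} (?r (insert t M)) :: ('a xyvar, 'k) mpoly set)"
      by (rule segre_prime_mono) (use M in \<open>auto split: if_splits\<close>)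
    moreover have "minor t (r t) \<in> (segre_prime U (xy {}) (?r (insert t M)) :: ('a xyvar, 'k) mpoly set)"
      using t insert.prems by (intro minor_in_segre_prime) auto
    moreover have "minor t (r t) \<notin> (segre_prime U (xy {}) (?r M) :: ('a xyvar, 'k) mpoly set)"
      using t insert by (intro minor_notin_segre_prime) auto
    ultimately have "segre_prime U {} (?r M) \<subset> (segre_prime U {} (?r (insert t M)) :: ('a xyvar, 'k) mpoly set)"
      by (auto simp: xy_def)
    moreover have "?chain (segre_prime U {} (?r M)) (card M)"
      using insert by simp
    ultimately show ?case
      using has_chain_step[OF _ is_prime_segre_prime] insert.hyps by simp
  qed
  have "segre_prime U {} (\<lambda>i. if i \<in> N then r i else i) = ?P {}"
    using rT by (simp add: xy_def) (rule segre_prime_cong, auto simp: N_def)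
  then have start: "?chain (?P {}) (card N)"
    using merge[OF fin(2) subset_refl] by simp
  have "?chain (?P S) (card N + 2 * card S)" if "finite S" "S \<subseteq> T" for S
    using that
  proof (induction S rule: finite_induct)
    case (insert t S)
    have "?chain (?P (insert t S)) (Suc (Suc (card N + 2 * card S)))"
    proof (rule chain_kill_isolated)
      fix j assume "j \<in> U" "r j = r t"
      then show "j = t" using insert.prems rT r[of j] by (cases "j \<in> T") auto
    qed (use insert T in auto)
    then show ?case using insert.hyps by simp
  qed (simp add: start)
  then have lower: "?chain (?P T) (card N + 2 * card T)" using fin by blast
  have upper: "n \<le> card N + 2 * card T" if n: "?chain (?P T) n" for n
  proof -
    have "?chain (?P (M \<union> T)) (n + card M)" if "finite M" "M \<subseteq> N" for M
      using that
    proof (induction M rule: finite_induct)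
      case (insert t M)
      have "?chain (?P (insert t (M \<union> T))) (Suc (n + card M))"
        by (rule chain_kill) (use insert sub in auto)
      then show ?case using insert.hyps by simp
    qed (simp add: n)
    then have mid: "?chain (?P (N \<union> T)) (n + card N)" using fin by blast
    have "?chain (?P (S \<union> (N \<union> T))) (n + card N + 2 * card S)" if "finite S" "S \<subseteq> R" for S
      using that
    proof (induction S rule: finite_induct)
      case (insert t S)
      have "?chain (?P (insert t (S \<union> (N \<union> T)))) (Suc (Suc (n + card N + 2 * card S)))"
      proof (rule chain_kill_isolated)
        fix j assume "j \<in> U" "j \<notin> S \<union> (N \<union> T)" "r j = r t"
        then show "j = t" using insert.prems by (auto simp: R_def N_def)
      qed (use insert sub in auto)
      then show ?case using insert.hyps by simp
    qed (simp add: mid)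
    then have "?chain (?P (R \<union> (N \<union> T))) (n + card N + 2 * card R)" using fin by blast
    then have "n + card N + 2 * card R \<le> card (xy U)"
      using U by (intro has_chain_le) (auto simp: xy_def)
    also have "card (xy U) \<le> card U + card U"
      unfolding xy_def by (rule order_trans[OF card_Un_le add_mono[OF card_image_le card_image_le]]) (use U in auto)
    finally show ?thesis using card_U by simp
  qed
  have "card N + 2 * card T = card U + card T - card (r ` (U - T))"
    using card_U R by simp
  then show ?thesis
    using prime_height_eqI[OF lower upper] by simp
qed

section \<open>Primes containing the minors\<close>

context
  fixes V :: "'v set" and Q :: "('v, 'k::field) mpoly set"
  assumes Q: "is_prime V Q"
begin

lemma cong_trans: "p - q \<in> Q \<Longrightarrow> q - s \<in> Q \<Longrightarrow> p - s \<in> Q"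
  using is_primeD(4)[OF Q, of "p - q" "q - s"] by simp

lemma cong_mult:
  assumes "p - p' \<in> Q" "q - q' \<in> Q" "p \<in> polys_in V" "q' \<in> polys_in V"
  shows "p * q - p' * q' \<in> Q"
proof -
  have "p * (q - q') + (p - p') * q' \<in> Q"
    by (intro is_primeD(4,6,7)[OF Q] assms)
  then show ?thesis by (simp add: algebra_simps)
qed

lemma cong_power:
  assumes "p - p' \<in> Q" "p \<in> polys_in V" "p' \<in> polys_in V"
  shows "p ^ n - p' ^ n \<in> Q \<and> p ^ n \<in> polys_in V \<and> p' ^ n \<in> polys_in V"
proof (induction n)
  case 0
  show ?case using is_primeD(2)[OF Q] by (simp add: polys_in_intros)
next
  case (Suc n)
  then show ?case using cong_mult[OF assms(1)] assms by (simp add: polys_in_intros)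
qed

lemma cong_mon_eval:
  assumes "\<And>v. v \<in> keys m \<Longrightarrow> F v - G v \<in> Q \<and> F v \<in> polys_in V \<and> G v \<in> polys_in V"
  shows "mon_eval F m - mon_eval G m \<in> Q"
proof -
  have "(\<Prod>v\<in>A. F v ^ lookup m v) - (\<Prod>v\<in>A. G v ^ lookup m v) \<in> Q
      \<and> (\<Prod>v\<in>A. F v ^ lookup m v) \<in> polys_in V \<and> (\<Prod>v\<in>A. G v ^ lookup m v) \<in> polys_in V"
    if "finite A" "A \<subseteq> keys m" for A
    using that
  proof (induction A rule: finite_induct)
    case empty
    show ?case using is_primeD(2)[OF Q] by (simp add: polys_in_intros)
  next
    case (insert v A)
    have "F v ^ lookup m v - G v ^ lookup m v \<in> Q \<and> F v ^ lookup m v \<in> polys_in V \<and> G v ^ lookup m v \<in> polys_in V"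
      using insert.prems assms[of v] by (intro cong_power) auto
    then show ?case
      using insert cong_mult[of "F v ^ lookup m v" "G v ^ lookup m v"] by (simp add: polys_in_intros)
  qed
  from this[of "keys m"] show ?thesis by (simp add: mon_eval_def)
qed

lemma mon_eval_notin_prime:
  assumes "\<And>v. v \<in> keys m \<Longrightarrow> F v \<notin> Q \<and> F v \<in> polys_in V"
  shows "mon_eval F m \<notin> Q \<and> mon_eval F m \<in> polys_in V"
proof -
  have pw: "p ^ n \<notin> Q \<and> p ^ n \<in> polys_in V" if "p \<notin> Q" "p \<in> polys_in V" for p n
    using that is_primeD(3)[OF Q] is_primeD(8)[OF Q, of p]
    by (induction n) (auto simp: polys_in_intros)
  have "(\<Prod>v\<in>A. F v ^ lookup m v) \<notin> Q \<and> (\<Prod>v\<in>A. F v ^ lookup m v) \<in> polys_in V"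
    if "finite A" "A \<subseteq> keys m" for A
    using that
  proof (induction A rule: finite_induct)
    case empty
    show ?case using is_primeD(3)[OF Q] by (simp add: polys_in_intros)
  next
    case (insert v A)
    have "F v ^ lookup m v \<notin> Q \<and> F v ^ lookup m v \<in> polys_in V"
      using insert.prems assms[of v] by (intro pw) auto
    then show ?case
      using insert is_primeD(8)[OF Q, of "F v ^ lookup m v"] by (auto simp: polys_in_intros)
  qed
  from this[of "keys m"] show ?thesis by (simp add: mon_eval_def)
qed

end

text \<open>
  A monomial without variables from \<open>Z\<close> has as image a monomial with coefficient 1, which is why
  the kernel is spanned by monomials and differences of two monomials.
\<close>

lemma mon_eval_segre_map:
  assumes "keys m \<inter> Z = {}"
  shows "\<exists>k. mon_eval (segre_map Z r) m = single k (1::'k::field)"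
proof -
  have pw: "\<exists>k. p ^ n = single k (1::'k)" if "\<exists>k. p = single k 1" for p :: "('b, 'k) mpoly" and n
  proof (induction n)
    case 0
    show ?case by (rule exI[of _ 0]) simp
  next
    case (Suc n)
    then show ?case using that by (auto simp: mult_single)
  qed
  have "\<exists>k. (\<Prod>v\<in>A. segre_map Z r v ^ lookup m v) = single k (1::'k)" if "finite A" "A \<subseteq> keys m" for A
    using that
  proof (induction A rule: finite_induct)
    case empty
    show ?case by (rule exI[of _ 0]) simp
  next
    case (insert v A)
    have "v \<notin> Z" using insert.prems assms by auto
    then have "\<exists>k. segre_map Z r v = single k (1::'k)"
      by (cases v; simp add: segre_map_def var_def mult_single; blast)
    then have "\<exists>k. segre_map Z r v ^ lookup m v = single k (1::'k)" by (rule pw)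
    then show ?case using insert by (auto simp: mult_single)
  qed
  from this[of "keys m"] show ?thesis by (simp add: mon_eval_def)
qed

text \<open>
  The Segre prime is spanned by the monomials that meet \<open>xy T\<close> and by the differences \<open>m - m'\<close> of
  monomials with the same image, so it suffices to find the latter in \<open>Q\<close>. In each class the
  representative has an entry \<open>pivot\<close> outside \<open>Q\<close>. Modulo \<open>Q\<close> the minors say that multiplying column \<open>i\<close> by
  the pivot of its class gives the same as the representative multiplied by an entry of
  column \<open>i\<close>, and the latter depends only on the image of the column under the parametrisation. So a
  product of pivots times \<open>m - m'\<close> lies in \<open>Q\<close>, and \<open>Q\<close> is prime.
\<close>

lemma segre_prime_subset:
  fixes Q :: "('a xyvar, 'k::field) mpoly set"
  assumes Q: "is_prime (xy U) Q"
    and T: "T = {i \<in> U. var (XV i) \<in> Q \<and> var (YV i) \<in> Q}"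
    and r: "\<And>i. i \<in> U - T \<Longrightarrow> r i \<in> U - T"
    and minors: "\<And>i. i \<in> U - T \<Longrightarrow> minor i (r i) \<in> Q"
  shows "segre_prime U (xy T) r \<subseteq> Q"
proof -
  let ?F = "segre_map (xy T) r :: 'a xyvar \<Rightarrow> ('a segre_var, 'k) mpoly"
  define pivot :: "'a \<Rightarrow> ('a xyvar, 'k) mpoly" where
    "pivot k = (if var (XV k) \<in> Q then var (YV k) else var (XV k))" for k
  define \<psi> :: "'a segre_var \<Rightarrow> ('a xyvar, 'k) mpoly" where
    "\<psi> w = (case w of Fst k \<Rightarrow> var (XV k) | Snd k \<Rightarrow> var (YV k)
       | Scale i \<Rightarrow> if var (XV (r i)) \<in> Q then var (YV i) else var (XV i))" for w
  \<comment> \<open>\<open>\<psi>\<close> recovers a monomial from its image up to pivots, and \<open>\<chi>\<close> recovers the product of these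
    pivots; both factor through the image, which makes them agree for \<open>m\<close> and \<open>m'\<close>\<close>
  define \<chi> :: "'a segre_var \<Rightarrow> ('a xyvar, 'k) mpoly" where
    "\<chi> w = (case w of Scale i \<Rightarrow> pivot (r i) | _ \<Rightarrow> 1)" for w
  define a :: "'a xyvar \<Rightarrow> ('a xyvar, 'k) mpoly" where
    "a v = (case v of XV i \<Rightarrow> pivot (r i) | YV i \<Rightarrow> pivot (r i))" for v
  define M :: "('a xyvar \<Rightarrow>\<^sub>0 nat) set" where "M = {m. keys m \<subseteq> xy (U - T)}"
  have a: "a v \<notin> Q \<and> a v \<in> polys_in (xy U)" if v: "v \<in> xy (U - T)" for v
  proof -
    obtain i where i: "i \<in> U - T" "v = XV i \<or> v = YV i" using v by (auto simp: xy_def)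
    have "r i \<in> U - T" using r i by blast
    then have "pivot (r i) \<notin> Q \<and> pivot (r i) \<in> polys_in (xy U)"
      by (auto simp: T pivot_def polys_in_intros)
    then show ?thesis using i by (auto simp: a_def)
  qed
  have step: "a v * var v - poly_subst \<psi> (?F v) \<in> Q \<and> a v * var v \<in> polys_in (xy U)
      \<and> poly_subst \<psi> (?F v) \<in> polys_in (xy U)" if v: "v \<in> xy (U - T)" for v
  proof -
    obtain i where i: "i \<in> U - T" "v = XV i \<or> v = YV i" using v by (auto simp: xy_def)
    have ri: "r i \<in> U - T" using r i by blast
    have "minor i (r i) \<in> Q" using minors i by blast
    then have mi: "var (XV (r i)) * var (YV i) - var (YV (r i)) * var (XV i) \<in> Q"
        "var (YV (r i)) * var (XV i) - var (XV (r i)) * var (YV i) \<in> Q"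
      using is_primeD(5)[OF Q is_primeD(2)[OF Q], of "minor i (r i)"]
      by (simp_all add: minor_def mult.commute)
    show ?thesis
      using i ri mi is_primeD(2)[OF Q]
      by (auto simp: a_def pivot_def \<psi>_def segre_map_def polys_in_intros)
  qed
  have cong1: "mon_eval a m * single m 1 - poly_subst \<psi> (mon_eval ?F m) \<in> Q" if "m \<in> M" for m
  proof -
    have "mon_eval (\<lambda>v. a v * var v) m - mon_eval (\<lambda>v. poly_subst \<psi> (?F v)) m \<in> Q"
      using that step by (intro cong_mon_eval[OF Q]) (auto simp: M_def)
    then show ?thesis by (simp add: mon_eval_mult mon_eval_var poly_subst_mon_eval)
  qed
  have a_eq: "mon_eval a m = poly_subst \<chi> (mon_eval ?F m)" if "m \<in> M" for m
  proof -
    have "a v = poly_subst \<chi> (?F v)" if "v \<in> xy (U - T)" for v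
      using that by (auto simp: xy_def a_def \<chi>_def segre_map_def)
    then have "mon_eval a m = mon_eval (\<lambda>v. poly_subst \<chi> (?F v)) m"
      unfolding mon_eval_def using that by (intro prod.cong) (auto simp: M_def)
    then show ?thesis by (simp add: poly_subst_mon_eval)
  qed
  have M_in: "single m 1 \<in> polys_in (xy U)" if "m \<in> M" for m
    using that by (intro polys_in_intros) (auto simp: M_def xy_def)
  have cong2: "single m 1 - single m' 1 \<in> Q" if m: "m \<in> M" "m' \<in> M" "mon_eval ?F m = mon_eval ?F m'" for m m'
  proof -
    have eq: "mon_eval a m = mon_eval a m'" using a_eq m by simp
    have "poly_subst \<psi> (mon_eval ?F m') - mon_eval a m' * single m' 1 \<in> Q"
      using is_primeD(5)[OF Q is_primeD(2)[OF Q] cong1[OF m(2)]] by simp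
    then have "mon_eval a m * single m 1 - mon_eval a m' * single m' 1 \<in> Q"
      using cong_trans[OF Q cong1[OF m(1)]] m(3) by simp
    then have "mon_eval a m * (single m 1 - single m' 1) \<in> Q"
      by (simp add: eq right_diff_distrib)
    moreover have "mon_eval a m \<notin> Q \<and> mon_eval a m \<in> polys_in (xy U)"
      using m(1) a by (intro mon_eval_notin_prime[OF Q]) (auto simp: M_def)
    ultimately show ?thesis
      using is_primeD(8)[OF Q, of "mon_eval a m"] M_in m polys_in_diff by blast
  qed
  \<comment> \<open>a linear section of the parametrisation on monomials, well defined modulo \<open>Q\<close> by \<open>cong2\<close>\<close>
  define \<rho> :: "('a segre_var \<Rightarrow>\<^sub>0 nat) \<Rightarrow> ('a xyvar, 'k) mpoly" where
    "\<rho> k = single (SOME m. m \<in> M \<and> mon_eval ?F m = single k 1) 1" for k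
  have mono: "single m 1 - lin_ext \<rho> (mon_eval ?F m) \<in> Q" if m: "keys m \<subseteq> xy U" for m
  proof (cases "m \<in> M")
    case True
    then have "keys m \<inter> xy T = {}" by (auto simp: M_def xy_def)
    then obtain k where k: "mon_eval ?F m = single k 1" using mon_eval_segre_map by blast
    define n where "n = (SOME n. n \<in> M \<and> mon_eval ?F n = single k 1)"
    have "n \<in> M \<and> mon_eval ?F n = single k 1"
      unfolding n_def by (rule someI[of _ m]) (use True k in simp)
    then have "single m 1 - single n 1 \<in> Q" using True k by (intro cong2) auto
    then show ?thesis by (simp add: k lin_ext_single \<rho>_def n_def)
  next
    case False
    have "xy (U - T) = xy U - xy T" by (auto simp: xy_def)
    then obtain v where v: "v \<in> keys m" "v \<in> xy T" using m False unfolding M_def by blast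
    have "mon_eval ?F m = 0"
      unfolding mon_eval_def
      by (rule prod_zero) (use v in \<open>auto simp: segre_map_def in_keys_iff power_0_left intro!: bexI[of _ v]\<close>)
    moreover have "single m 1 \<in> Q"
    proof -
      obtain n where n: "m = single v 1 + n"
      proof
        show "m = single v 1 + (m - single v 1)"
          by (rule poly_mapping_eqI)
            (use v(1) in \<open>auto simp: lookup_add lookup_minus lookup_single when_def in_keys_iff\<close>)
      qed
      have "keys n \<subseteq> keys m"
        by (auto simp: n in_keys_iff lookup_add)
      then have "single n 1 \<in> (polys_in (xy U) :: ('a xyvar, 'k) mpoly set)"
        using m by (intro polys_in_intros) auto
      moreover have "var v \<in> Q" using v(2) by (auto simp: T xy_def)
      ultimately have "var v * single n 1 \<in> Q" by (intro is_primeD(7)[OF Q])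
      then show ?thesis by (simp add: var_def n mult_single)
    qed
    ultimately show ?thesis by simp
  qed
  show ?thesis
  proof
    fix p :: "('a xyvar, 'k) mpoly" assume p: "p \<in> segre_prime U (xy T) r"
    have "lin_ext \<rho> (poly_subst ?F p) = (\<Sum>m\<in>keys p. single 0 (lookup p m) * lin_ext \<rho> (mon_eval ?F m))"
      by (simp add: poly_subst_def lin_ext_def[of "mon_eval ?F" p] lin_ext_sum lin_ext_scale)
    then have zero: "(\<Sum>m\<in>keys p. single 0 (lookup p m) * lin_ext \<rho> (mon_eval ?F m)) = 0"
      using p by (simp add: segre_prime_def subst_kernel_def)
    have "p = (\<Sum>m\<in>keys p. single 0 (lookup p m) * single m 1)"
      using poly_mapping_sum_singles[of p] by (simp add: mult_single)
    also have "\<dots> = (\<Sum>m\<in>keys p. single 0 (lookup p m) * (single m 1 - lin_ext \<rho> (mon_eval ?F m)))"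
      by (simp add: right_diff_distrib sum_subtractf zero)
    also have "\<dots> \<in> Q"
    proof (rule is_prime_sum[OF Q])
      fix m assume "m \<in> keys p"
      then have "keys m \<subseteq> xy U"
        using p by (auto simp: segre_prime_def subst_kernel_def polys_in_def)
      then show "single 0 (lookup p m) * (single m 1 - lin_ext \<rho> (mon_eval ?F m)) \<in> Q"
        by (intro is_primeD(6)[OF Q] mono polys_in_intros)
    qed
    finally show "p \<in> Q" .
  qed
qed

section \<open>Components and cut vertices\<close>

lemma verts_remove [simp]: "verts (remove G T) = verts G - T"
  by (auto simp: remove_def induced_def)

lemma edges_remove: "edges (remove G T) = {e \<in> edges G. e \<subseteq> verts G - T}"
  by (simp add: remove_def induced_def)

lemma remove_remove: "remove (remove G A) B = remove G (A \<union> B)"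
  by (auto simp: remove_def induced_def)

lemma remove_empty: "simple_graph G \<Longrightarrow> remove G {} = G"
proof -
  assume "simple_graph G"
  then have "{e \<in> edges G. e \<subseteq> verts G} = edges G" unfolding simple_graph_def by blast
  then show ?thesis by (simp add: remove_def induced_def)
qed

lemma simple_graph_remove: "simple_graph G \<Longrightarrow> simple_graph (remove G T)"
  unfolding remove_def by (rule simple_graph_induced)

lemma simple_graph_edge:
  "simple_graph G \<Longrightarrow> {a, b} \<in> edges G \<Longrightarrow> a \<in> verts G \<and> b \<in> verts G \<and> a \<noteq> b"
  by (auto simp: simple_graph_def)

lemma linked_verts: "(u, v) \<in> linked G \<Longrightarrow> u \<in> verts G \<and> v \<in> verts G"
  by (simp add: linked_def)

lemma linked_refl: "u \<in> verts G \<Longrightarrow> (u, u) \<in> linked G"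
  by (simp add: linked_def)

lemma linked_sym: "(u, v) \<in> linked G \<Longrightarrow> (v, u) \<in> linked G"
proof -
  have "sym {(a, b). {a, b} \<in> edges G}" by (auto simp: sym_def insert_commute)
  then have "sym ({(a, b). {a, b} \<in> edges G}\<^sup>*)" by (rule sym_rtrancl)
  then show "(u, v) \<in> linked G \<Longrightarrow> (v, u) \<in> linked G" by (auto simp: linked_def dest: symD)
qed

lemma linked_trans: "(u, v) \<in> linked G \<Longrightarrow> (v, w) \<in> linked G \<Longrightarrow> (u, w) \<in> linked G"
  by (auto simp: linked_def)

lemma equiv_linked: "equiv (verts G) (linked G)"
  by (intro equivI refl_onI symI transI)
    (auto intro: linked_refl linked_sym linked_trans dest: linked_verts)

lemma linked_edge: "simple_graph G \<Longrightarrow> {u, v} \<in> edges G \<Longrightarrow> (u, v) \<in> linked G"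
  using simple_graph_edge[of G u v] by (auto simp: linked_def)

lemma linked_induct [consumes 1, case_names refl step]:
  assumes "(u, v) \<in> linked G" and "P u"
    and "\<And>v w. (u, v) \<in> linked G \<Longrightarrow> {v, w} \<in> edges G \<Longrightarrow> w \<in> verts G \<Longrightarrow> P v \<Longrightarrow> P w"
    and "simple_graph G"
  shows "P v"
proof -
  have u: "u \<in> verts G" using assms(1) by (simp add: linked_def)
  have "(u, v) \<in> {(a, b). {a, b} \<in> edges G}\<^sup>*" using assms(1) by (simp add: linked_def)
  then have "(u, v) \<in> linked G \<and> P v"
  proof (induction rule: rtrancl_induct)
    case base
    then show ?case using u assms(2) by (simp add: linked_refl)
  next
    case (step v w)
    then have "{v, w} \<in> edges G" by simp
    then show ?case
      using step.IH assms(3,4) linked_edge[of G v w] linked_trans simple_graph_edge by metis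
  qed
  then show ?thesis ..
qed

lemma linked_mono:
  assumes "simple_graph G" "(u, v) \<in> linked G" "verts G \<subseteq> verts H" "edges G \<subseteq> edges H" "simple_graph H"
  shows "(u, v) \<in> linked H"
  using assms(2)
proof (induction rule: linked_induct)
  case refl
  then show ?case using assms(2,3) linked_verts linked_refl by fast
next
  case (step v w)
  then show ?case using assms(4,5) linked_edge linked_trans by fast
qed (rule assms(1))

lemma finite_components: "simple_graph G \<Longrightarrow> finite (components G)"
  unfolding components_def by (rule finite_quotient) (auto simp: simple_graph_def dest: linked_verts)

lemma components_eq_image: "components G = (\<lambda>u. linked G `` {u}) ` verts G"
  by (auto simp: components_def quotient_def)

lemma component_eq_iff:
  "u \<in> verts G \<Longrightarrow> v \<in> verts G \<Longrightarrow> linked G `` {u} = linked G `` {v} \<longleftrightarrow> (u, v) \<in> linked G"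
  using equiv_linked by (rule eq_equiv_class_iff)

text \<open>
  A map that reflects linkedness induces an injection on components. Stating this with vertices
  avoids choosing elements of components each time.
\<close>

lemma card_components_le:
  fixes G :: "'a graph" and H :: "'b graph"
  assumes "simple_graph H" and f: "\<And>u. u \<in> verts G \<Longrightarrow> f u \<in> verts H"
    and inj: "\<And>u v. u \<in> verts G \<Longrightarrow> v \<in> verts G \<Longrightarrow> (f u, f v) \<in> linked H \<Longrightarrow> (u, v) \<in> linked G"
  shows "card (components G) \<le> card (components H)"
proof -
  define r where "r C = (SOME u. u \<in> C)" for C :: "'a set"
  have r: "r C \<in> verts G \<and> linked G `` {r C} = C" if "C \<in> components G" for C
  proof -
    obtain u where u: "u \<in> verts G" "C = linked G `` {u}" using \<open>C \<in> components G\<close> by (auto simp: components_eq_image)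
    then have "u \<in> C" by (simp add: linked_refl)
    then have "r C \<in> C" unfolding r_def by (rule someI)
    then have "(u, r C) \<in> linked G" using u by simp
    then show ?thesis using u component_eq_iff[of u G "r C"] linked_verts by fast
  qed
  show ?thesis
  proof (rule card_inj_on_le[OF _ _ finite_components[OF assms(1)]])
    show "inj_on (\<lambda>C. linked H `` {f (r C)}) (components G)"
    proof (rule inj_onI)
      fix C D assume CD: "C \<in> components G" "D \<in> components G" "linked H `` {f (r C)} = linked H `` {f (r D)}"
      then have "(f (r C), f (r D)) \<in> linked H"
        using r[of C] r[of D] f component_eq_iff[of "f (r C)" H "f (r D)"] by simp
      then have "(r C, r D) \<in> linked G" using r[of C] r[of D] CD inj by blast
      then show "C = D" using r[of C] r[of D] CD component_eq_iff[of "r C" G "r D"] by simp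
    qed
    show "(\<lambda>C. linked H `` {f (r C)}) ` components G \<subseteq> components H"
      using r f by (auto simp: components_eq_image)
  qed
qed

text \<open>
  A walk through \<open>t\<close> enters and leaves by neighbours of \<open>t\<close>, so a detour around \<open>t\<close> exists.
\<close>

lemma linked_remove_vertex:
  assumes G: "simple_graph G"
    and nb: "\<And>i j. {t, i} \<in> edges G \<Longrightarrow> {t, j} \<in> edges G \<Longrightarrow> (i, j) \<in> linked (remove G {t})"
    and uv: "(u, v) \<in> linked G" "u \<noteq> t" "v \<noteq> t"
  shows "(u, v) \<in> linked (remove G {t})"
proof -
  let ?H = "remove G {t}"
  have H: "simple_graph ?H" using G by (rule simple_graph_remove)
  have "(v \<noteq> t \<longrightarrow> (u, v) \<in> linked ?H) \<and> (v = t \<longrightarrow> (\<exists>i. {t, i} \<in> edges G \<and> (u, i) \<in> linked ?H))"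
    using uv(1)
  proof (induction rule: linked_induct)
    case refl
    then show ?case using uv linked_verts[OF uv(1)] by (simp add: linked_refl)
  next
    case (step v w)
    note e = simple_graph_edge[OF G step(2)]
    show ?case
    proof (cases "v = t")
      case True
      then show ?thesis using step e nb linked_trans by metis
    next
      case False
      then have uv: "(u, v) \<in> linked ?H" using step by simp
      show ?thesis
      proof (cases "w = t")
        case True
        then show ?thesis using step uv by (auto simp: insert_commute)
      next
        case w: False
        then have "{v, w} \<in> edges ?H" using step(2) e False by (simp add: edges_remove)
        then have "(v, w) \<in> linked ?H" by (rule linked_edge[OF H])
        then show ?thesis using w uv linked_trans by metis
      qed
    qed
  qed (rule G)
  then show ?thesis using uv by simp
qed

text \<open>
  This turns the comparison of two numbers of components into a local condition. Sending a
  component of \<open>G - t\<close> to the component of \<open>G\<close> that contains it is onto as soon as \<open>t\<close> has a neighbour,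
  and it is not injective exactly when two neighbours of \<open>t\<close> are separated by \<open>t\<close>.
\<close>

lemma cut_vertex_iff:
  assumes G: "simple_graph G"
  shows "cut_vertex G t \<longleftrightarrow>
    (\<exists>i j. {t, i} \<in> edges G \<and> {t, j} \<in> edges G \<and> (i, j) \<notin> linked (remove G {t}))"
proof
  let ?H = "remove G {t}"
  have H: "simple_graph ?H" using G by (rule simple_graph_remove)
  {
    assume "\<not> (\<exists>i j. {t, i} \<in> edges G \<and> {t, j} \<in> edges G \<and> (i, j) \<notin> linked ?H)"
    then have nb: "(i, j) \<in> linked ?H" if "{t, i} \<in> edges G" "{t, j} \<in> edges G" for i j
      using that by blast
    have "card (components ?H) \<le> card (components G)"
    proof (rule card_components_le[OF G])
      fix u v assume "u \<in> verts ?H" "v \<in> verts ?H" "(u, v) \<in> linked G"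
      then show "(u, v) \<in> linked ?H" using linked_remove_vertex[OF G nb, of u v] by simp
    qed simp
    then have "\<not> cut_vertex G t" by (simp add: cut_vertex_def)
  }
  then show "cut_vertex G t \<Longrightarrow> \<exists>i j. {t, i} \<in> edges G \<and> {t, j} \<in> edges G \<and> (i, j) \<notin> linked ?H"
    by blast
  assume "\<exists>i j. {t, i} \<in> edges G \<and> {t, j} \<in> edges G \<and> (i, j) \<notin> linked ?H"
  then obtain i j where ij: "{t, i} \<in> edges G" "{t, j} \<in> edges G" "(i, j) \<notin> linked ?H" by blast
  have t: "t \<in> verts G" "i \<in> verts ?H" "j \<in> verts ?H"
    using simple_graph_edge[OF G ij(1)] simple_graph_edge[OF G ij(2)] by auto
  let ?f = "\<lambda>C. linked G `` C"
  have HG: "(u, v) \<in> linked G" if "(u, v) \<in> linked ?H" for u v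
    by (rule linked_mono[OF H that _ _ G]) (auto simp: edges_remove)
  have f: "?f (linked ?H `` {u}) = linked G `` {u}" if "u \<in> verts ?H" for u
  proof
    show "?f (linked ?H `` {u}) \<subseteq> linked G `` {u}"
    proof
      fix x assume "x \<in> ?f (linked ?H `` {u})"
      then obtain w where "(u, w) \<in> linked ?H" "(w, x) \<in> linked G" by blast
      then show "x \<in> linked G `` {u}" using HG[of u w] linked_trans[of u w G x] by simp
    qed
    show "linked G `` {u} \<subseteq> ?f (linked ?H `` {u})"
      using linked_refl[OF that] by blast
  qed
  have "components G = ?f ` components ?H"
  proof
    show "?f ` components ?H \<subseteq> components G"
    proof
      fix C assume "C \<in> ?f ` components ?H"
      then obtain u where u: "u \<in> verts ?H" "C = ?f (linked ?H `` {u})"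
        unfolding components_eq_image by blast
      then have "C = linked G `` {u}" using f by simp
      then show "C \<in> components G" using u(1) by (simp add: components_eq_image)
    qed
    show "components G \<subseteq> ?f ` components ?H"
    proof
      fix C assume "C \<in> components G"
      then obtain u where u: "u \<in> verts G" "C = linked G `` {u}" by (auto simp: components_eq_image)
      define w where "w = (if u = t then i else u)"
      have w: "w \<in> verts ?H" using u t by (auto simp: w_def)
      have "(u, w) \<in> linked G"
        using u linked_edge[OF G ij(1)] by (auto simp: w_def linked_refl)
      then have "C = linked G `` {w}" using u w component_eq_iff[of u G w] by simp
      also have "\<dots> = ?f (linked ?H `` {w})" using f w by simp
      finally show "C \<in> ?f ` components ?H" using w by (auto simp: components_eq_image)
    qed
  qed
  moreover have "\<not> inj_on ?f (components ?H)"
  proof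
    assume inj: "inj_on ?f (components ?H)"
    have "(i, j) \<in> linked G"
      using linked_edge[OF G ij(1)] linked_edge[OF G ij(2)] linked_sym linked_trans by metis
    then have "?f (linked ?H `` {i}) = ?f (linked ?H `` {j})"
      using f t component_eq_iff[of i G j] by simp
    then have "linked ?H `` {i} = linked ?H `` {j}"
      by (rule inj_onD[OF inj]) (use t in \<open>auto simp: components_eq_image\<close>)
    then show False using ij(3) component_eq_iff[of i ?H j] t by simp
  qed
  ultimately have "card (components G) < card (components ?H)"
    using finite_components[OF H] card_image_le[of "components ?H" ?f] eq_card_imp_inj_on[of "components ?H" ?f]
    by fastforce
  then show "cut_vertex G t" using t by (simp add: cut_vertex_def)
qed

lemma cutset_empty: "cutset G {}"
  by (simp add: cutset_def)

section \<open>Unmixedness of binomial edge ideals\<close>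

text \<open>
  A vertex chosen in the component of \<open>i\<close> in \<open>G - T\<close>, so that equality of representatives expresses
  linkedness. Vertices in \<open>T\<close> represent themselves, which keeps them alone in their classes.
\<close>

definition rep :: "'a graph \<Rightarrow> 'a set \<Rightarrow> 'a \<Rightarrow> 'a" where
  "rep G T i = (if i \<in> verts G - T then SOME j. j \<in> linked (remove G T) `` {i} else i)"

text \<open>
  The prime \<open>P\<^sub>T(G)\<close>: it is generated by the variables of \<open>T\<close> and by the minors of all pairs of vertices
  in a common component of \<open>G - T\<close>.
\<close>

definition cut_prime :: "'a graph \<Rightarrow> 'a set \<Rightarrow> ('a xyvar, 'k::field) mpoly set" where
  "cut_prime G T = segre_prime (verts G) (xy T) (rep G T)"

lemma rep_linked: "i \<in> verts G - T \<Longrightarrow> (i, rep G T i) \<in> linked (remove G T)"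
  unfolding rep_def using someI[of "\<lambda>j. j \<in> linked (remove G T) `` {i}" i]
  by (simp add: linked_refl)

lemma rep_eq_iff:
  assumes "i \<in> verts G - T" "j \<in> verts G - T"
  shows "rep G T i = rep G T j \<longleftrightarrow> (i, j) \<in> linked (remove G T)"
proof
  assume "rep G T i = rep G T j"
  then show "(i, j) \<in> linked (remove G T)"
    using rep_linked[OF assms(1)] rep_linked[OF assms(2)] linked_sym linked_trans by metis
next
  assume "(i, j) \<in> linked (remove G T)"
  then have "linked (remove G T) `` {i} = linked (remove G T) `` {j}"
    using assms component_eq_iff[of i "remove G T" j] by simp
  then show "rep G T i = rep G T j" using assms by (simp add: rep_def)
qed

lemma rep_idem:
  assumes "i \<in> verts G - T"
  shows "rep G T i \<in> verts G - T \<and> rep G T (rep G T i) = rep G T i"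
proof -
  have "(i, rep G T i) \<in> linked (remove G T)" using assms by (rule rep_linked)
  moreover from this have "rep G T i \<in> verts G - T" using linked_verts by fastforce
  ultimately show ?thesis using rep_eq_iff[of "rep G T i" G T i] assms linked_sym by metis
qed

lemma card_rep:
  "card (rep G T ` (verts G - T)) = card (components (remove G T))"
proof -
  let ?H = "remove G T" and ?f = "\<lambda>i. linked (remove G T) `` {i}"
  have "?f i = ?f (rep G T i)" if "i \<in> verts G - T" for i
    using component_eq_iff[of i ?H "rep G T i"] rep_linked[OF that] linked_verts[OF rep_linked[OF that]]
    by simp
  then have "components ?H = ?f ` rep G T ` (verts G - T)"
    by (simp add: components_eq_image image_image)
  moreover have "inj_on ?f (rep G T ` (verts G - T))"
  proof (rule inj_onI)
    fix a b assume ab: "a \<in> rep G T ` (verts G - T)" "b \<in> rep G T ` (verts G - T)" "?f a = ?f b"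
    from ab(1) obtain i where "a = rep G T i" "i \<in> verts G - T" by (rule imageE)
    then have a: "a \<in> verts G - T" "rep G T a = a" using rep_idem[of i G T] by simp_all
    from ab(2) obtain j where "b = rep G T j" "j \<in> verts G - T" by (rule imageE)
    then have b: "b \<in> verts G - T" "rep G T b = b" using rep_idem[of j G T] by simp_all
    note v = a(1) b(1) a(2) b(2)
    then have "(a, b) \<in> linked ?H" using ab(3) component_eq_iff[of a ?H b] by simp
    then show "a = b" using rep_eq_iff[of a G T b] v by simp
  qed
  ultimately show ?thesis by (simp add: card_image)
qed

lemma edge_ring_eq: "edge_ring G = mpoly_ring (xy (verts G))"
  by (simp add: edge_ring_def xy_def)

lemma height_cut_prime:
  assumes "simple_graph G" "T \<subseteq> verts G"
  shows "prime_height (edge_ring G) (cut_prime G T :: ('a xyvar, 'k::field) mpoly set)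
    = enat (card (verts G) + card T - card (components (remove G T)))"
  unfolding edge_ring_eq cut_prime_def card_rep[symmetric]
proof (rule height_segre_prime)
  show "rep G T i = i" if "i \<in> T" for i using that by (simp add: rep_def)
qed (use assms in \<open>simp_all only: rep_idem simple_graph_def\<close>)

lemma card_components_le_verts: "simple_graph G \<Longrightarrow> card (components G) \<le> card (verts G)"
  unfolding components_eq_image by (rule card_image_le) (simp add: simple_graph_def)

lemma binomial_edge_ideal_subset_iff:
  fixes P :: "('a xyvar, 'k::field) mpoly set"
  assumes "is_prime (xy (verts G)) P"
  shows "binomial_edge_ideal G \<subseteq> P \<longleftrightarrow> (\<forall>i j. {i, j} \<in> edges G \<longrightarrow> minor i j \<in> P)"
proof -
  interpret primeideal P "edge_ring G" using assms by (simp add: is_prime_def edge_ring_eq)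
  let ?M = "{minor i j |i j. {i, j} \<in> edges G} :: ('a xyvar, 'k) mpoly set"
  have "?M \<subseteq> P \<Longrightarrow> binomial_edge_ideal G \<subseteq> P"
    unfolding binomial_edge_ideal_def minor_def by (rule genideal_minimal[OF ideal_axioms])
  moreover have "?M \<subseteq> binomial_edge_ideal G"
    unfolding binomial_edge_ideal_def minor_def genideal_def by blast
  ultimately show ?thesis by blast
qed

lemma minor_in_cut_prime:
  "i \<in> verts G - T \<Longrightarrow> j \<in> verts G - T \<Longrightarrow> minor i j \<in> cut_prime G T \<longleftrightarrow> (i, j) \<in> linked (remove G T)"
  unfolding cut_prime_def
  using minor_in_segre_prime[of i "verts G" j T "rep G T"] minor_notin_segre_prime[of i T j "rep G T" "verts G"]
    rep_eq_iff[of i G T j] by blast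

lemma cut_prime_contains:
  assumes G: "simple_graph G"
  shows "binomial_edge_ideal G \<subseteq> (cut_prime G T :: ('a xyvar, 'k::field) mpoly set)"
proof -
  have "minor i j \<in> (cut_prime G T :: ('a xyvar, 'k) mpoly set)" if e: "{i, j} \<in> edges G" for i j
  proof -
    have v: "i \<in> verts G" "j \<in> verts G" using simple_graph_edge[OF G e] by auto
    have "i \<in> T \<or> j \<in> T \<or> rep G T i = rep G T j"
    proof (rule ccontr)
      assume *: "\<not> ?thesis"
      then have "{i, j} \<in> edges (remove G T)" using e v by (simp add: edges_remove)
      then have "(i, j) \<in> linked (remove G T)" using linked_edge simple_graph_remove G by metis
      then show False using * v rep_eq_iff[of i G T j] by simp
    qed
    then show ?thesis unfolding cut_prime_def by (rule minor_in_segre_prime[OF v])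
  qed
  then show ?thesis
    by (subst binomial_edge_ideal_subset_iff) (auto simp: cut_prime_def is_prime_segre_prime)
qed

text \<open>
  Modulo \<open>Q\<close>, adjacent columns are proportional, and proportionality is transitive through nonzero
  columns; the columns that are zero modulo \<open>Q\<close> are those in \<open>T\<close>.
\<close>

lemma prime_contains_cut_prime:
  fixes Q :: "('a xyvar, 'k::field) mpoly set"
  assumes G: "simple_graph G" and Q: "is_prime (xy (verts G)) Q" "binomial_edge_ideal G \<subseteq> Q"
    and T: "T = {i \<in> verts G. var (XV i) \<in> Q \<and> var (YV i) \<in> Q}"
  shows "cut_prime G T \<subseteq> Q"
  unfolding cut_prime_def
proof (rule segre_prime_subset[OF Q(1) T])
  let ?H = "remove G T"
  have H: "simple_graph ?H" using G by (rule simple_graph_remove)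
  have edge: "minor i j \<in> Q" if "{i, j} \<in> edges G" for i j
    using Q(2) that unfolding binomial_edge_ideal_subset_iff[OF Q(1)] by blast
  fix i assume i: "i \<in> verts G - T"
  show "rep G T i \<in> verts G - T" using rep_idem[OF i] ..
  have "minor i j \<in> Q" if "(i, j) \<in> linked ?H" for j
    using that
  proof (induction rule: linked_induct)
    case refl
    show ?case using is_primeD(2)[OF Q(1)] by (simp add: minor_def)
  next
    case (step j k)
    have jk: "minor j k \<in> Q" using step(2) by (intro edge) (simp add: edges_remove)
    have v: "i \<in> verts G" "j \<in> verts G - T" "k \<in> verts G"
      using i step(2,3) simple_graph_edge[OF H step(2)] by auto
    let ?x = "\<lambda>i. var (XV i) :: ('a xyvar, 'k) mpoly" and ?y = "\<lambda>i. var (YV i) :: ('a xyvar, 'k) mpoly"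
    have var: "?x j \<in> polys_in (xy (verts G))" "?y j \<in> polys_in (xy (verts G))"
      "?x i \<in> polys_in (xy (verts G))" "?y i \<in> polys_in (xy (verts G))"
      "?x k \<in> polys_in (xy (verts G))" "?y k \<in> polys_in (xy (verts G))"
      using v by (auto intro!: polys_in_intros)
    \<comment> \<open>at a vertex where not both coordinates vanish, proportionality is transitive\<close>
    have "?x j * minor i k = ?x k * minor i j + ?x i * minor j k"
      "?y j * minor i k = ?y k * minor i j + ?y i * minor j k"
      by (simp_all add: minor_def algebra_simps)
    moreover have "?x k * minor i j + ?x i * minor j k \<in> Q"
      "?y k * minor i j + ?y i * minor j k \<in> Q"
      by (intro is_primeD(4,6)[OF Q(1)] jk step.IH var)+
    ultimately have mult: "?x j * minor i k \<in> Q" "?y j * minor i k \<in> Q"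
      by simp_all
    have "(minor i k :: ('a xyvar, 'k) mpoly) \<in> polys_in (xy (verts G))"
      using v by (intro minor_polys_in) auto
    then have "var (XV j) \<in> Q \<or> minor i k \<in> Q" "var (YV j) \<in> Q \<or> minor i k \<in> Q"
      using is_primeD(8)[OF Q(1) var(1) _ mult(1)] is_primeD(8)[OF Q(1) var(2) _ mult(2)] by blast+
    moreover have "var (XV j) \<notin> Q \<or> var (YV j) \<notin> Q" using v T by auto
    ultimately show ?case by blast
  qed (rule H)
  then show "minor i (rep G T i) \<in> Q" using rep_linked[OF i] .
qed


lemma minimal_prime_iff:
  "minimal_prime (edge_ring G) J P \<longleftrightarrow> is_prime (xy (verts G)) P \<and> J \<subseteq> P \<and>
     (\<forall>Q. is_prime (xy (verts G)) Q \<and> J \<subseteq> Q \<and> Q \<subseteq> P \<longrightarrow> Q = P)"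
  by (simp add: minimal_prime_def is_prime_def edge_ring_eq)

lemma is_prime_cut_prime: "is_prime (xy (verts G)) (cut_prime G T)"
  by (simp add: cut_prime_def is_prime_segre_prime)

lemma cut_prime_var:
  "i \<in> verts G \<Longrightarrow> var (XV i) \<in> cut_prime G T \<longleftrightarrow> i \<in> T"
  "i \<in> verts G \<Longrightarrow> var (YV i) \<in> cut_prime G T \<longleftrightarrow> i \<in> T"
  by (simp_all add: cut_prime_def var_in_segre_prime)

text \<open>
  A smaller prime would contain \<open>P\<^sub>T\<^sub>'\<close> for some \<open>T' \<subset> T\<close>. Any \<open>t \<in> T - T'\<close> separates two of its
  neighbours \<open>i\<close>, \<open>j\<close> in \<open>G - (T - {t})\<close>, but it joins them in \<open>G - T'\<close>. So the minor of \<open>i\<close> and \<open>j\<close> lies in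
  the smaller prime and not in \<open>P\<^sub>T\<close>.
\<close>

lemma cut_prime_minimal:
  assumes G: "simple_graph G" and T: "cutset G T"
  shows "minimal_prime (edge_ring G) (binomial_edge_ideal G :: ('a xyvar, 'k::field) mpoly set) (cut_prime G T)"
  unfolding minimal_prime_iff
proof (intro conjI allI impI)
  let ?P = "cut_prime G T :: ('a xyvar, 'k) mpoly set"
  show "is_prime (xy (verts G)) ?P" by (rule is_prime_cut_prime)
  show "binomial_edge_ideal G \<subseteq> ?P" by (rule cut_prime_contains[OF G])
  fix Q assume "is_prime (xy (verts G)) Q \<and> binomial_edge_ideal G \<subseteq> Q \<and> Q \<subseteq> ?P"
  then have Q: "is_prime (xy (verts G)) Q" "binomial_edge_ideal G \<subseteq> Q" "Q \<subseteq> ?P" by blast+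
  define T' where "T' = {i \<in> verts G. var (XV i) \<in> Q \<and> var (YV i) \<in> Q}"
  have sub: "cut_prime G T' \<subseteq> Q" by (rule prime_contains_cut_prime[OF G Q(1,2) T'_def])
  have "T' \<subseteq> T" using Q(3) by (auto simp: T'_def cut_prime_var dest: subsetD)
  moreover have "T \<subseteq> T'"
  proof (rule ccontr)
    assume "\<not> T \<subseteq> T'"
    then obtain t where t: "t \<in> T" "t \<notin> T'" by blast
    let ?H = "remove G (T - {t})" and ?H' = "remove G T'"
    have H: "simple_graph ?H" and H': "simple_graph ?H'" using G by (simp_all add: simple_graph_remove)
    have eq: "remove ?H {t} = remove G T"
      using t(1) by (simp add: remove_remove insert_absorb)
    have "cut_vertex ?H t" using T t(1) unfolding cutset_def by blast
    then obtain i j where ij: "{t, i} \<in> edges ?H" "{t, j} \<in> edges ?H" "(i, j) \<notin> linked (remove G T)"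
      unfolding cut_vertex_iff[OF H] eq by blast
    have v: "i \<in> verts G - T" "j \<in> verts G - T"
      using simple_graph_edge[OF H ij(1)] simple_graph_edge[OF H ij(2)] by auto
    have "{t, i} \<in> edges ?H'" "{t, j} \<in> edges ?H'"
      using ij(1,2) v \<open>T' \<subseteq> T\<close> t by (auto simp: edges_remove)
    then have "(i, j) \<in> linked ?H'"
      by (intro linked_trans[OF linked_sym[OF linked_edge[OF H']] linked_edge[OF H']])
    moreover have "i \<in> verts G - T'" "j \<in> verts G - T'" using v \<open>T' \<subseteq> T\<close> by auto
    ultimately have "minor i j \<in> (cut_prime G T' :: ('a xyvar, 'k) mpoly set)"
      by (simp only: minor_in_cut_prime)
    then have "minor i j \<in> ?P" using sub Q(3) by blast
    then have "(i, j) \<in> linked (remove G T)" using v by (simp only: minor_in_cut_prime)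
    then show False using ij(3) by blast
  qed
  ultimately have "T' = T" by (rule antisym)
  then show "Q = ?P" using sub Q(3) by blast
qed

text \<open>
  A minimal prime is some \<open>P\<^sub>T\<close>. If \<open>t \<in> T\<close> is not a cut vertex of \<open>G - (T - {t})\<close>, then deleting \<open>t\<close>
  separates nothing, so that \<open>P\<close> for \<open>T - {t}\<close> is strictly smaller.
\<close>

lemma minimal_prime_cut_prime:
  assumes G: "simple_graph G"
    and P: "minimal_prime (edge_ring G) (binomial_edge_ideal G :: ('a xyvar, 'k::field) mpoly set) P"
  shows "\<exists>T. cutset G T \<and> P = cut_prime G T"
proof -
  have prime: "is_prime (xy (verts G)) P" and J: "binomial_edge_ideal G \<subseteq> P"
    and min: "\<And>Q. is_prime (xy (verts G)) Q \<Longrightarrow> binomial_edge_ideal G \<subseteq> Q \<Longrightarrow> Q \<subseteq> P \<Longrightarrow> Q = P"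
    using P unfolding minimal_prime_iff by blast+
  define T where "T = {i \<in> verts G. var (XV i) \<in> P \<and> var (YV i) \<in> P}"
  have P_eq: "P = cut_prime G T"
    using min[OF is_prime_cut_prime cut_prime_contains[OF G] prime_contains_cut_prime[OF G prime J T_def]]
    by simp
  have "cutset G T"
    unfolding cutset_def
  proof (intro conjI ballI)
    show "T \<subseteq> verts G" by (auto simp: T_def)
    fix t assume t: "t \<in> T"
    let ?H = "remove G (T - {t})"
    have H: "simple_graph ?H" using G by (rule simple_graph_remove)
    have eq: "remove ?H {t} = remove G T"
      using t by (simp add: remove_remove insert_absorb)
    show "cut_vertex ?H t"
    proof (rule ccontr)
      assume "\<not> cut_vertex ?H t"
      then have nb: "(i, j) \<in> linked (remove ?H {t})" if "{t, i} \<in> edges ?H" "{t, j} \<in> edges ?H" for i j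
        using that unfolding cut_vertex_iff[OF H] by blast
      have "cut_prime G (T - {t}) \<subseteq> (cut_prime G T :: ('a xyvar, 'k) mpoly set)"
        unfolding cut_prime_def
      proof (rule segre_prime_mono)
        fix i j
        assume ij: "i \<in> verts G" "j \<in> verts G" "\<not> (XV i \<in> xy T \<and> YV i \<in> xy T)"
          "\<not> (XV j \<in> xy T \<and> YV j \<in> xy T)" "rep G (T - {t}) i = rep G (T - {t}) j"
        then have v: "i \<notin> T" "j \<notin> T" by auto
        then have "(i, j) \<in> linked ?H" using ij rep_eq_iff[of i G "T - {t}" j] by simp
        then have "(i, j) \<in> linked (remove G T)"
          using linked_remove_vertex[OF H nb, of i j] v t unfolding eq by blast
        then have "rep G T i = rep G T j" using ij v rep_eq_iff[of i G T j] by simp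
        then show "rep G T i = rep G T j \<and> (XV i \<in> xy T) = (XV j \<in> xy T) \<and> (YV i \<in> xy T) = (YV j \<in> xy T)"
          using v by simp
      qed (auto simp: xy_def)
      then have "cut_prime G (T - {t}) = P"
        using min[OF is_prime_cut_prime cut_prime_contains[OF G]] P_eq by blast
      moreover have "var (XV t) \<in> P" "t \<in> verts G" using t by (auto simp: T_def)
      ultimately show False using cut_prime_var(1)[of t G "T - {t}"] by blast
    qed
  qed
  then show ?thesis using P_eq by blast
qed

text \<open>
  The minimal primes are the \<open>P\<^sub>T\<close> for cutsets \<open>T\<close>, and the height of \<open>P\<^sub>T\<close> is
  \<open>card (verts G) + card T - c\<^sub>G(T)\<close>. The empty set is a cutset, so all heights agree exactly if they
  agree with the one for the empty set.
\<close>

lemma unmixed_iff: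
  fixes G :: "'a graph"
  assumes G: "simple_graph G"
  shows "unmixed (edge_ring G) (binomial_edge_ideal G :: ('a xyvar, 'k::field) mpoly set)
    \<longleftrightarrow> (\<forall>T. cutset G T \<longrightarrow> card (components (remove G T)) = card T + card (components G))"
proof -
  let ?J = "binomial_edge_ideal G :: ('a xyvar, 'k) mpoly set" and ?R = "edge_ring G :: ('a xyvar, 'k) mpoly ring"
  let ?c = "\<lambda>T. card (components (remove G T))" and ?n = "card (verts G)"
  have G_eq: "remove G {} = G" using G by (rule remove_empty)
  have le: "?c T \<le> ?n" for T
  proof -
    have "?c T \<le> card (verts (remove G T))"
      by (rule card_components_le_verts[OF simple_graph_remove[OF G]])
    also have "\<dots> \<le> ?n" using G by (simp add: card_mono simple_graph_def)
    finally show ?thesis .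
  qed
  have height: "prime_height ?R (cut_prime G T) = enat (?n + card T - ?c T)" if "cutset G T" for T
    using that by (intro height_cut_prime G) (simp add: cutset_def)
  have sub: "?n + card T - ?c T = ?n - card (components G) \<longleftrightarrow> ?c T = card T + card (components G)" for T
    using le[of T] le[of "{}"] G_eq by auto
  have zero: "prime_height ?R (cut_prime G {}) = enat (?n - card (components G))"
    using height[OF cutset_empty] G_eq by simp
  show ?thesis
  proof
    assume un: "unmixed ?R ?J"
    show "\<forall>T. cutset G T \<longrightarrow> ?c T = card T + card (components G)"
    proof (intro allI impI)
      fix T assume T: "cutset G T"
      have "prime_height ?R (cut_prime G T) = prime_height ?R (cut_prime G {})"
        using un cut_prime_minimal[OF G T] cut_prime_minimal[OF G cutset_empty]
        unfolding unmixed_def by blast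
      then show "?c T = card T + card (components G)"
        unfolding height[OF T] zero using sub[of T] by simp
    qed
  next
    assume c: "\<forall>T. cutset G T \<longrightarrow> ?c T = card T + card (components G)"
    have "prime_height ?R P = enat (?n - card (components G))" if P: "minimal_prime ?R ?J P" for P
    proof -
      obtain T where T: "cutset G T" "P = cut_prime G T"
        using minimal_prime_cut_prime[OF G P] by blast
      then show ?thesis using height[OF T(1)] sub[of T] c by simp
    qed
    then show "unmixed ?R ?J" unfolding unmixed_def by metis
  qed
qed

section \<open>Blocks and branches\<close>

lemma verts_induced: "S \<subseteq> verts G \<Longrightarrow> verts (induced G S) = S"
  by (auto simp: induced_def)

lemma edges_induced: "edges (induced G S) = {e \<in> edges G. e \<subseteq> S}"
  by (simp add: induced_def)

lemma linked_map:
  assumes "simple_graph K" "(u, v) \<in> linked K"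
    and verts: "\<And>a. a \<in> verts K \<Longrightarrow> f a \<in> verts L"
    and edge: "\<And>a b. {a, b} \<in> edges K \<Longrightarrow> (f a, f b) \<in> linked L"
  shows "(f u, f v) \<in> linked L"
  using assms(2)
proof (induction rule: linked_induct)
  case refl
  show ?case using linked_verts[OF assms(2)] verts by (simp add: linked_refl)
next
  case (step v w)
  then show ?case using edge linked_trans by metis
qed (rule assms(1))

lemma linked_path:
  assumes "simple_graph K" "(u, v) \<in> linked K"
  shows "\<exists>p. p \<noteq> [] \<and> hd p = u \<and> last p = v \<and> set p \<subseteq> verts K
    \<and> successively (\<lambda>x y. {x, y} \<in> edges K) p \<and> distinct p"
  using assms(2)
proof (induction rule: linked_induct)
  case refl
  show ?case by (rule exI[of _ "[u]"]) (use linked_verts[OF assms(2)] in simp)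
next
  case (step v w)
  then obtain p where p: "p \<noteq> []" "hd p = u" "last p = v" "set p \<subseteq> verts K"
    "successively (\<lambda>x y. {x, y} \<in> edges K) p" "distinct p" by blast
  show ?case
  proof (cases "w \<in> set p")
    case True
    then obtain xs ys where "p = xs @ w # ys" by (meson split_list)
    then have eq: "p = (xs @ [w]) @ ys" by simp
    have "successively (\<lambda>x y. {x, y} \<in> edges K) (xs @ [w])"
      using p(5) unfolding eq by (simp only: successively_append_iff)
    moreover have "hd (xs @ [w]) = u" using p(2) unfolding eq by (cases xs) simp_all
    ultimately show ?thesis
      using p(4,6) unfolding eq by (intro exI[of _ "xs @ [w]"]) simp
  next
    case False
    then show ?thesis
      by (intro exI[of _ "p @ [w]"]) (simp add: successively_append_iff p step(2,3))
  qed
qed (rule assms(1))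

lemma path_linked:
  assumes "simple_graph K" "set p \<subseteq> verts K" "successively (\<lambda>x y. {x, y} \<in> edges K) p" "x \<in> set p" "y \<in> set p"
  shows "(x, y) \<in> linked K"
proof -
  have "(hd p, x) \<in> linked K" if "x \<in> set p" for x
    using assms(2,3) that
  proof (induction p)
    case (Cons a p)
    show ?case
    proof (cases "x = a")
      case True
      then show ?thesis using Cons.prems by (simp add: linked_refl)
    next
      case False
      then have x: "x \<in> set p" using Cons.prems by simp
      then have "{a, hd p} \<in> edges K" "successively (\<lambda>x y. {x, y} \<in> edges K) p"
        using Cons.prems(2) by (cases p; simp)+
      moreover from this have "(hd p, x) \<in> linked K" using Cons x by simp
      ultimately show ?thesis using linked_edge[OF assms(1)] linked_trans[of a "hd p" K x] by simp
    qed
  qed simp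
  from this[OF assms(4)] this[OF assms(5)] show ?thesis
    using linked_sym linked_trans by fast
qed

text \<open>
  This is the last vertex before a walk from \<open>u\<close> enters \<open>S\<close>, together with the vertex of entry.
\<close>

lemma exit_edge:
  assumes G: "simple_graph G" and us: "(u, s) \<in> linked G" "s \<in> S" "u \<notin> S"
  shows "\<exists>d b. (u, d) \<in> linked (remove G S) \<and> b \<in> S \<and> {d, b} \<in> edges G"
proof (rule ccontr)
  assume no: "\<not> ?thesis"
  have "(u, s) \<in> linked (remove G S)"
    using us(1)
  proof (induction rule: linked_induct)
    case refl
    show ?case using us linked_verts[OF us(1)] by (simp add: linked_refl)
  next
    case (step v w)
    then have "w \<notin> S" "v \<notin> S" using no linked_verts[OF step(4)] by auto
    then have "{v, w} \<in> edges (remove G S)"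
      using step(2) simple_graph_edge[OF G step(2)] by (simp add: edges_remove)
    then show ?case
      using step(4) linked_edge[OF simple_graph_remove[OF G]] linked_trans by fast
  qed (rule G)
  then show False using us linked_verts by fastforce
qed

lemma nonseparable_linked:
  assumes H: "simple_graph H" "nonseparable H" and ab: "a \<in> verts H - {v}" "b \<in> verts H - {v}"
  shows "(a, b) \<in> linked (remove H {v})"
proof (rule linked_remove_vertex[OF H(1)])
  show "(i, j) \<in> linked (remove H {v})" if "{v, i} \<in> edges H" "{v, j} \<in> edges H" for i j
    using that H(2) unfolding nonseparable_def cut_vertex_iff[OF H(1)] by blast
  show "(a, b) \<in> linked H" using H(2) ab unfolding nonseparable_def graph_connected_def by blast
qed (use ab in auto)

lemma nonseparableI:
  assumes H: "simple_graph H" "verts H \<noteq> {}"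
    and l: "\<And>X a b. X = {} \<or> (\<exists>v. X = {v}) \<Longrightarrow> a \<in> verts H - X \<Longrightarrow> b \<in> verts H - X \<Longrightarrow> (a, b) \<in> linked (remove H X)"
  shows "nonseparable H"
  unfolding nonseparable_def
proof (intro conjI allI)
  show "graph_connected H"
    using l[of "{}"] H unfolding graph_connected_def remove_empty[OF H(1)] by simp
  fix v
  show "\<not> cut_vertex H v"
  proof
    assume "cut_vertex H v"
    then obtain i j where ij: "{v, i} \<in> edges H" "{v, j} \<in> edges H" "(i, j) \<notin> linked (remove H {v})"
      unfolding cut_vertex_iff[OF H(1)] by blast
    have "i \<in> verts H - {v}" "j \<in> verts H - {v}"
      using simple_graph_edge[OF H(1) ij(1)] simple_graph_edge[OF H(1) ij(2)] by auto
    then show False using l[of "{v}" i j] ij(3) by blast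
  qed
qed

lemma component_linked:
  assumes "C \<in> components G" "u \<in> C"
  shows "u \<in> verts G" "v \<in> C \<longleftrightarrow> (u, v) \<in> linked G"
proof -
  obtain w where w: "w \<in> verts G" "C = linked G `` {w}"
    using assms(1) by (auto simp: components_eq_image)
  then have "(w, u) \<in> linked G" using assms(2) by simp
  then show "u \<in> verts G" "v \<in> C \<longleftrightarrow> (u, v) \<in> linked G"
    using w(2) linked_verts[of w u G] linked_sym[of w u G] linked_trans[of u w G v] linked_trans[of w u G v]
    by blast+
qed

lemma component_of: "u \<in> verts G \<Longrightarrow> linked G `` {u} \<in> components G \<and> u \<in> linked G `` {u}"
  by (auto simp: components_eq_image linked_refl)

lemma card_components_connected: "graph_connected G \<Longrightarrow> card (components G) = 1"
proof -
  assume G: "graph_connected G"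
  then have "linked G `` {u} = verts G" if "u \<in> verts G" for u
    using that linked_verts unfolding graph_connected_def by fast
  then have "components G = {verts G}"
    using G unfolding components_eq_image graph_connected_def by auto
  then show ?thesis by simp
qed

context
  fixes G B :: "'a graph"
  assumes G: "simple_graph G" and conn: "graph_connected G" and block: "is_block G B"
    and unm: "\<forall>T. cutset G T \<longrightarrow> card (components (remove G T)) = card T + card (components G)"
begin

private abbreviation (input) "S \<equiv> verts B"

lemma block_eq: "S \<subseteq> verts G" "B = induced G S" "edges B = {e \<in> edges G. e \<subseteq> S}"
proof -
  obtain S' where "S' \<subseteq> verts G" "B = induced G S'" using block unfolding is_block_def by blast
  then show "S \<subseteq> verts G" "B = induced G S" "edges B = {e \<in> edges G. e \<subseteq> S}"
    by (simp_all add: verts_induced edges_induced)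
qed

lemma block_simple: "simple_graph B"
  using G block_eq(2) simple_graph_induced by metis

lemma block_nonsep: "nonseparable B"
  using block unfolding is_block_def by blast

lemma block_max: "S \<subset> S' \<Longrightarrow> S' \<subseteq> verts G \<Longrightarrow> \<not> nonseparable (induced G S')"
  using block unfolding is_block_def by blast

lemma block_linked:
  assumes K: "simple_graph K" "\<And>e. e \<in> edges B \<Longrightarrow> e \<subseteq> S - X \<Longrightarrow> e \<in> edges K" "S - X \<subseteq> verts K"
    and X: "X = {} \<or> (\<exists>v. X = {v})" and ab: "a \<in> S - X" "b \<in> S - X"
  shows "(a, b) \<in> linked K"
proof -
  have "(a, b) \<in> linked (remove B X)"
    using X
  proof
    assume "X = {}"
    then show ?thesis using block_nonsep ab
      unfolding nonseparable_def graph_connected_def by (simp add: remove_empty[OF block_simple])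
  next
    assume "\<exists>v. X = {v}"
    then show ?thesis using nonseparable_linked[OF block_simple block_nonsep] ab by blast
  qed
  then show ?thesis
    by (rule linked_mono[OF simple_graph_remove[OF block_simple]]) (use K in \<open>auto simp: edges_remove\<close>)
qed

text \<open>
  Otherwise a path from \<open>d\<close> to \<open>d'\<close> outside the block is an ear attached at two different vertices
  of the block. The block together with this path is still nonseparable: if a vertex of the path is
  deleted, then each of the two remaining parts hangs on the block by its own end, and if a vertex
  of the block is deleted, then at least one end of the path is still attached.
\<close>

lemma no_ear:
  assumes b: "b \<in> S" "b' \<in> S" "{d, b} \<in> edges G" "{d', b'} \<in> edges G"
    and dd': "(d, d') \<in> linked (remove G S)"
  shows "b = b'"
proof (rule ccontr)
  assume ne: "b \<noteq> b'"
  obtain p where p: "p \<noteq> []" "hd p = d" "last p = d'" "set p \<subseteq> verts (remove G S)"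
    "successively (\<lambda>x y. {x, y} \<in> edges (remove G S)) p" "distinct p"
    using linked_path[OF simple_graph_remove[OF G] dd'] by blast
  define H where "H = induced G (S \<union> set p)"
  have sub: "S \<union> set p \<subseteq> verts G" and disj: "S \<inter> set p = {}" using block_eq(1) p(4) by auto
  have H: "simple_graph H" "verts H = S \<union> set p" "edges H = {e \<in> edges G. e \<subseteq> S \<union> set p}"
    using simple_graph_induced[OF G] verts_induced[OF sub] by (simp_all add: H_def edges_induced)
  have mem: "d \<in> set p" "d' \<in> set p" using p(1-3) by auto
  have "nonseparable H"
  proof (rule nonseparableI[OF H(1)])
    show "verts H \<noteq> {}" using b by (auto simp: H(2))
    fix X x y assume X: "X = {} \<or> (\<exists>v. X = {v})" and xy: "x \<in> verts H - X" "y \<in> verts H - X"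
    let ?K = "remove H X"
    have K: "simple_graph ?K" using H(1) by (rule simple_graph_remove)
    have S_linked: "(s, s') \<in> linked ?K" if "s \<in> S - X" "s' \<in> S - X" for s s'
      by (rule block_linked[OF K _ _ X that]) (auto simp: edges_remove H block_eq(3))
    have p_linked: "(s, s') \<in> linked ?K"
      if "s \<in> set q" "s' \<in> set q" "set q \<subseteq> set p - X" "successively (\<lambda>x y. {x, y} \<in> edges (remove G S)) q" for q s s'
    proof (rule path_linked[OF K, of q])
      show "set q \<subseteq> verts ?K" using that(3) by (auto simp: H)
      show "successively (\<lambda>x y. {x, y} \<in> edges ?K) q"
        by (rule successively_mono[OF that(4)]) (use that(3) in \<open>auto simp: edges_remove H\<close>)
    qed (use that in auto)
    have ends: "b \<notin> X \<Longrightarrow> d \<notin> X \<Longrightarrow> (d, b) \<in> linked ?K" "b' \<notin> X \<Longrightarrow> d' \<notin> X \<Longrightarrow> (d', b') \<in> linked ?K"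
      using b mem by (auto intro!: linked_edge[OF K] simp: edges_remove H)
    \<comment> \<open>all remaining vertices are linked to a common vertex of the block\<close>
    have "\<exists>c \<in> S - X. \<forall>z \<in> verts H - X. (z, c) \<in> linked ?K"
    proof (cases "X \<inter> set p = {}")
      case True
      then have pX: "set p \<subseteq> set p - X" by auto
      obtain c e where c: "c \<in> S - X" "e \<in> set p" "(e, c) \<in> linked ?K"
      proof (cases "b \<in> X")
        \<comment> \<open>if one end of the ear lost its vertex of attachment, the other end did not\<close>
        case True
        then have "b' \<notin> X" using X ne by auto
        then show ?thesis using that[of b' d'] ends(2) b mem pX by auto
      next
        case False
        then show ?thesis using that[of b d] ends(1) b mem pX by auto
      qed
      have "(z, c) \<in> linked ?K" if "z \<in> verts H - X" for z
      proof (cases "z \<in> S")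
        case True
        then show ?thesis using S_linked that c by blast
      next
        case False
        then have "(z, e) \<in> linked ?K" using that c H p_linked[OF _ _ pX p(5)] by auto
        then show ?thesis using c(3) linked_trans by fast
      qed
      then show ?thesis using c by blast
    next
      case False
      then obtain v where v: "v \<in> set p" "X = {v}" using X by auto
      then have bX: "b \<in> S - X" "b' \<in> S - X" and Sv: "v \<notin> S" using b disj by auto
      obtain q1 q2 where q: "p = q1 @ v # q2" using v(1) by (meson split_list)
      have qs: "set q1 \<subseteq> set p - X" "set q2 \<subseteq> set p - X"
        using p(6) v(2) by (auto simp: q)
      have succ: "successively (\<lambda>x y. {x, y} \<in> edges (remove G S)) q1"
        "successively (\<lambda>x y. {x, y} \<in> edges (remove G S)) (v # q2)"
        using p(5) unfolding q successively_append_iff by blast+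
      then have "successively (\<lambda>x y. {x, y} \<in> edges (remove G S)) q2"
        by (cases q2) simp_all
      note qs' = succ(1) this
      have "(z, b) \<in> linked ?K" if z: "z \<in> verts H - X" for z
      proof -
        consider "z \<in> S" | "z \<in> set q1" | "z \<in> set q2" using z v by (auto simp: H q)
        then show ?thesis
        proof cases
          case 1
          then show ?thesis using S_linked z bX by blast
        next
          case 2
          then have "d \<in> set q1" using p(2) by (cases q1) (auto simp: q)
          moreover from this have "d \<notin> X" using qs(1) by auto
          ultimately have "(z, d) \<in> linked ?K" "(d, b) \<in> linked ?K"
            using p_linked[OF 2 _ qs(1) qs'(1)] ends(1) bX by blast+
          then show ?thesis by (rule linked_trans)
        next
          case 3
          then have "d' \<in> set q2" using p(3) by (cases q2 rule: rev_cases) (auto simp: q)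
          moreover from this have "d' \<notin> X" using qs(2) by auto
          ultimately have "(z, d') \<in> linked ?K" "(d', b') \<in> linked ?K"
            using p_linked[OF 3 _ qs(2) qs'(2)] ends(2) bX by blast+
          then have "(z, b') \<in> linked ?K" by (rule linked_trans)
          then show ?thesis using S_linked[OF bX(2,1)] by (rule linked_trans)
        qed
      qed
      then show ?thesis using bX by blast
    qed
    then obtain c where "(x, c) \<in> linked ?K" "(y, c) \<in> linked ?K" using xy by blast
    then show "(x, y) \<in> linked ?K" using linked_sym[of y c ?K] linked_trans[of x c ?K y] by blast
  qed
  moreover have "S \<subset> S \<union> set p" using mem disj by auto
  ultimately show False using block_max[of "S \<union> set p"] sub H_def by blast
qed

text \<open>
  An edge with its two ends is nonseparable, so a single vertex with a neighbour is not a block.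
\<close>

lemma block_not_single:
  assumes "{b, d} \<in> edges G"
  shows "S \<noteq> {b}"
proof
  assume S: "S = {b}"
  have v: "b \<in> verts G" "d \<in> verts G" "b \<noteq> d" using simple_graph_edge[OF G assms] by auto
  let ?H = "induced G {b, d}"
  have H: "simple_graph ?H" "verts ?H = {b, d}" "edges ?H = {e \<in> edges G. e \<subseteq> {b, d}}"
    using simple_graph_induced[OF G] v by (simp_all add: verts_induced edges_induced)
  have "nonseparable ?H"
  proof (rule nonseparableI[OF H(1)])
    fix X x y assume X: "X = {} \<or> (\<exists>v. X = {v})" and xy: "x \<in> verts ?H - X" "y \<in> verts ?H - X"
    show "(x, y) \<in> linked (remove ?H X)"
    proof (cases "x = y")
      case True
      then show ?thesis using xy by (simp add: linked_refl)
    next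
      case False
      then have "{x, y} = {b, d}" using xy by (auto simp: H)
      then have "{x, y} \<in> edges G" using assms by simp
      then have "{x, y} \<in> edges (remove ?H X)" using xy unfolding edges_remove H by blast
      then show ?thesis by (rule linked_edge[OF simple_graph_remove[OF H(1)]])
    qed
  qed (simp add: H)
  then show False using block_max[of "{b, d}"] S v by auto
qed

lemma block_other: "{b, d} \<in> edges G \<Longrightarrow> \<exists>s\<in>S. s \<noteq> b"
proof -
  assume "{b, d} \<in> edges G"
  then have "S \<noteq> {b}" by (rule block_not_single)
  moreover have "S \<noteq> {}" using block_nonsep unfolding nonseparable_def graph_connected_def by blast
  ultimately show ?thesis by (metis subset_singletonD subsetI singleton_iff)
qed

text \<open>
  For a cut vertex \<open>v\<close> in the block this is the vertex set of the branch at \<open>v\<close>, without \<open>v\<close> itself.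
\<close>

definition side :: "'a \<Rightarrow> 'a set" where
  "side v = (THE C. C \<in> components (remove G {v}) \<and> C \<inter> S = {})"

text \<open>
  The set \<open>{v}\<close> is a cutset, so \<open>G - v\<close> has exactly two components. One of them contains the rest of the
  block, which is nonempty and stays connected.
\<close>

lemma side_ex1:
  assumes v: "v \<in> block_cut_verts G B"
  shows "\<exists>!C. C \<in> components (remove G {v}) \<and> C \<inter> S = {}"
proof -
  let ?K = "remove G {v}"
  have K: "simple_graph ?K" using G by (rule simple_graph_remove)
  have cut: "cut_vertex G v" and vS: "v \<in> S" using v by (auto simp: block_cut_verts_def)
  have "cutset G {v}" using cut vS block_eq(1) by (auto simp: cutset_def remove_empty[OF G])
  then have two: "card (components ?K) = 2"
    using unm card_components_connected[OF conn] by fastforce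
  obtain d where "{v, d} \<in> edges G" using cut unfolding cut_vertex_iff[OF G] by blast
  then obtain s where s: "s \<in> S" "s \<noteq> v" using block_other by blast
  let ?C0 = "linked ?K `` {s}"
  have C0: "?C0 \<in> components ?K" using s block_eq(1) component_of[of s ?K] by auto
  have sub: "S - {v} \<subseteq> ?C0"
  proof
    fix x assume "x \<in> S - {v}"
    then have "(s, x) \<in> linked ?K"
      by (intro block_linked[OF K, of "{v}"]) (use s block_eq in \<open>auto simp: edges_remove\<close>)
    then show "x \<in> ?C0" by simp
  qed
  obtain C1 where C1: "components ?K = {?C0, C1}" "C1 \<noteq> ?C0"
    using two C0 unfolding card_2_iff by (metis doubleton_eq_iff insert_iff singletonD)
  have d1: "C1 \<inter> S = {}"
  proof (rule ccontr)
    assume "C1 \<inter> S \<noteq> {}"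
    then obtain x where x: "x \<in> C1" "x \<in> S" by blast
    then have "x \<noteq> v" using component_linked(1)[of C1 ?K x] C1 by auto
    then have "x \<in> ?C0" using sub x by blast
    then have "C1 = ?C0" using component_linked(2)[of C1 ?K x] component_linked(2)[of ?C0 ?K x] C1(1) x(1) by blast
    then show False using C1 by blast
  qed
  have d0: "?C0 \<inter> S \<noteq> {}" using s sub by blast
  show ?thesis
    by (rule ex1I[of _ C1]) (use C1(1) d0 d1 in auto)
qed

lemma side:
  assumes "v \<in> block_cut_verts G B"
  shows "side v \<in> components (remove G {v})" "side v \<inter> S = {}"
    "C \<in> components (remove G {v}) \<Longrightarrow> C \<inter> S = {} \<Longrightarrow> C = side v"
  using theI'[OF side_ex1[OF assms]] the1_equality[OF side_ex1[OF assms], of C] unfolding side_def by blast+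

lemma side_verts: "v \<in> block_cut_verts G B \<Longrightarrow> side v \<subseteq> verts G - {v}"
  using component_linked(1)[OF side(1)] by fastforce

lemma branch_eq:
  assumes "v \<in> block_cut_verts G B"
  shows "verts (branch G B v) = insert v (side v)" "edges (branch G B v) = {e \<in> edges G. e \<subseteq> insert v (side v)}"
proof -
  have "v \<in> verts G" using assms block_eq(1) by (auto simp: block_cut_verts_def)
  then have "insert v (side v) \<subseteq> verts G" using side_verts[OF assms] by auto
  then show "verts (branch G B v) = insert v (side v)" "edges (branch G B v) = {e \<in> edges G. e \<subseteq> insert v (side v)}"
    by (simp_all add: branch_def side_def[symmetric] verts_induced edges_induced)
qed

text \<open>
  By \<open>no_ear\<close> the component of \<open>u\<close> outside the block is attached to the block at a single vertex \<open>b\<close>. So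
  \<open>b\<close> separates this component from the rest of the block.
\<close>

lemma side_cover:
  assumes u: "u \<in> verts G - S"
  shows "\<exists>v \<in> block_cut_verts G B. u \<in> side v"
proof -
  obtain s where "s \<in> S" using block_nonsep unfolding nonseparable_def graph_connected_def by blast
  moreover from this have "(u, s) \<in> linked G" using conn u block_eq(1) unfolding graph_connected_def by blast
  ultimately obtain d b where db: "(u, d) \<in> linked (remove G S)" "b \<in> S" "{d, b} \<in> edges G"
    using exit_edge[OF G, of u s S] u by blast
  let ?K = "remove G {b}"
  have K: "simple_graph ?K" using G by (rule simple_graph_remove)
  have stay: "(u, x) \<in> linked (remove G S)" if "(u, x) \<in> linked ?K" for x
    using that
  proof (induction rule: linked_induct)
    case refl
    show ?case using u by (simp add: linked_refl)
  next
    case (step x y)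
    have xy: "{x, y} \<in> edges G" using step(2) by (simp add: edges_remove)
    have x: "x \<notin> S" using linked_verts[OF step(4)] by simp
    have y: "y \<notin> S"
    proof
      assume "y \<in> S"
      moreover have "(d, x) \<in> linked (remove G S)" using db(1) step(4) linked_sym linked_trans by fast
      ultimately have "b = y" using no_ear[OF db(2) _ db(3) xy] by blast
      then show False using step(3) by simp
    qed
    then have "{x, y} \<in> edges (remove G S)"
      using xy x y simple_graph_edge[OF G xy] by (simp add: edges_remove)
    then show ?case using step(4) linked_edge[OF simple_graph_remove[OF G]] linked_trans by fast
  qed (rule K)
  have ub: "u \<in> verts ?K" using u db(2) by auto
  have bd: "{b, d} \<in> edges G" using db(3) by (simp add: insert_commute)
  have ud: "(u, d) \<in> linked ?K"
    by (rule linked_mono[OF simple_graph_remove[OF G] db(1) _ _ K]) (use db(2) in \<open>auto simp: edges_remove\<close>)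
  obtain s where s: "s \<in> S" "s \<noteq> b" using block_other[OF bd] by blast
  have us: "(u, s) \<notin> linked ?K" using stay[of s] s linked_verts[of u s "remove G S"] by auto
  have "cut_vertex G b"
  proof (rule ccontr)
    assume "\<not> cut_vertex G b"
    then have nb: "(i, j) \<in> linked ?K" if "{b, i} \<in> edges G" "{b, j} \<in> edges G" for i j
      using that unfolding cut_vertex_iff[OF G] by blast
    have "(u, s) \<in> linked G" using conn u s block_eq(1) unfolding graph_connected_def by blast
    moreover have "u \<noteq> b" using ub by simp
    ultimately have "(u, s) \<in> linked ?K"
      using linked_remove_vertex[OF G, of b u s] nb s(2) by blast
    then show False using us by blast
  qed
  then have b: "b \<in> block_cut_verts G B" using db(2) by (simp add: block_cut_verts_def)
  have "linked ?K `` {u} \<inter> S = {}" using stay linked_verts[of u _ "remove G S"] by fastforce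
  then have "linked ?K `` {u} = side b"
    using side(3)[OF b] component_of[OF ub] by blast
  then show ?thesis using b component_of[OF ub] by blast
qed

lemma side_edge:
  assumes v: "v \<in> block_cut_verts G B" and ab: "{a, b} \<in> edges G" "a \<in> side v"
  shows "b = v \<or> b \<in> side v"
proof (rule ccontr)
  assume *: "\<not> ?thesis"
  have "a \<noteq> v" using side_verts[OF v] ab(2) by blast
  then have "{a, b} \<in> edges (remove G {v})"
    using * ab(1) simple_graph_edge[OF G ab(1)] by (simp add: edges_remove)
  then have "(a, b) \<in> linked (remove G {v})" by (rule linked_edge[OF simple_graph_remove[OF G]])
  then show False using * component_linked(2)[OF side(1)[OF v] ab(2)] by blast
qed

lemma side_linked:
  assumes v: "v \<in> block_cut_verts G B" and T: "T \<inter> side v = {}" and ab: "a \<in> side v" "b \<in> side v"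
  shows "(a, b) \<in> linked (remove G T)"
proof -
  have ab': "(a, b) \<in> linked (remove G {v})" using component_linked(2)[OF side(1)[OF v] ab(1)] ab(2) by blast
  then show ?thesis
  proof (induction rule: linked_induct)
    case refl
    have "a \<in> verts (remove G T)" using ab(1) T side_verts[OF v] by auto
    then show ?case by (rule linked_refl)
  next
    case (step x y)
    have "x \<in> side v" using component_linked(2)[OF side(1)[OF v] ab(1)] step(1) by blast
    moreover have xy: "{x, y} \<in> edges G" using step(2) by (simp add: edges_remove)
    moreover have "y \<noteq> v" using step(3) by simp
    ultimately have "x \<in> side v" "y \<in> side v" using side_edge[OF v xy] by blast+
    then have "{x, y} \<in> edges (remove G T)"
      using xy T simple_graph_edge[OF G xy] by (auto simp: edges_remove)
    then show ?case using step(4) linked_edge[OF simple_graph_remove[OF G]] linked_trans by fast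
  qed (rule simple_graph_remove[OF G])
qed

lemma side_attached:
  assumes v: "v \<in> block_cut_verts G B"
  shows "\<exists>d \<in> side v. {d, v} \<in> edges G"
proof -
  obtain u where "u \<in> verts (remove G {v})" "side v = linked (remove G {v}) `` {u}"
    using side(1)[OF v] unfolding components_eq_image by blast
  then have u: "u \<in> side v" using component_of[of u "remove G {v}"] by blast
  have "(u, v) \<in> linked G"
    using conn u v side_verts[OF v] block_eq(1) unfolding graph_connected_def block_cut_verts_def by blast
  then obtain d where d: "(u, d) \<in> linked (remove G {v})" "{d, v} \<in> edges G"
    using exit_edge[OF G, of u v "{v}"] u side_verts[OF v] by blast
  then show ?thesis using component_linked(2)[OF side(1)[OF v] u] by blast
qed

lemma side_linked_root:
  assumes v: "v \<in> block_cut_verts G B" and T: "T \<inter> side v = {}" "v \<notin> T" and a: "a \<in> side v"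
  shows "(a, v) \<in> linked (remove G T)"
proof -
  obtain d where d: "d \<in> side v" "{d, v} \<in> edges G" using side_attached[OF v] by blast
  then have "{d, v} \<in> edges (remove G T)"
    using T simple_graph_edge[OF G d(2)] by (auto simp: edges_remove)
  then show ?thesis
    using side_linked[OF v T(1) a d(1)] linked_edge[OF simple_graph_remove[OF G]] linked_trans by fast
qed

text \<open>
  If \<open>u\<close> were on both sides, then it would be linked to \<open>v\<close> within its side of \<open>v\<close>, hence without
  meeting \<open>v'\<close>, so that \<open>v\<close>, a vertex of the block, would be on the side of \<open>v'\<close>.
\<close>

lemma side_disjoint:
  assumes v: "v \<in> block_cut_verts G B" "v' \<in> block_cut_verts G B" "v \<noteq> v'"
  shows "side v \<inter> side v' = {}"
proof (rule ccontr)
  assume "side v \<inter> side v' \<noteq> {}"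
  then obtain u where u: "u \<in> side v" "u \<in> side v'" by blast
  have vS: "v \<in> S" "v' \<in> S" using v by (auto simp: block_cut_verts_def)
  have "(u, v) \<in> linked (remove G {v'})"
    using side_linked_root[OF v(1) _ _ u(1), of "{v'}"] side(2)[OF v(1)] vS v(3) by blast
  then have "v \<in> side v'" using component_linked(2)[OF side(1)[OF v(2)] u(2)] by blast
  then show False using side(2)[OF v(2)] vS by blast
qed

section \<open>Replacing branches by whiskers\<close>

context
  fixes W
  assumes W: "W \<subseteq> block_cut_verts G B"
begin

private abbreviation (input) "H \<equiv> whiskered G B W"

definition kept :: "'a set" where
  "kept = verts G - (\<Union>v\<in>W. side v)"

lemma kept_side: "v \<in> W \<Longrightarrow> a \<in> side v \<Longrightarrow> a \<in> verts G \<and> a \<notin> kept"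
  using side_verts W by (auto simp: kept_def)

lemma not_kept: "a \<in> verts G \<Longrightarrow> a \<notin> kept \<Longrightarrow> \<exists>v\<in>W. a \<in> side v"
  by (auto simp: kept_def)

lemma block_kept: "S \<subseteq> kept"
  using side(2) W block_eq(1) by (fastforce simp: kept_def)

lemma W_kept: "W \<subseteq> kept"
  using W block_kept by (auto simp: block_cut_verts_def)

lemma verts_whiskered: "verts H = Inl ` kept \<union> Inr ` W"
proof -
  have "S \<union> (\<Union>v\<in>block_cut_verts G B - W. verts (branch G B v)) = kept"
  proof
    have "insert v (side v) \<subseteq> kept" if v: "v \<in> block_cut_verts G B - W" for v
    proof -
      have "side v \<subseteq> kept"
      proof -
        have "side v \<inter> side v' = {}" if "v' \<in> W" for v'
          using side_disjoint[of v v'] v W that by blast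
        then show ?thesis using side_verts[of v] v unfolding kept_def by blast
      qed
      then show ?thesis using v block_kept by (auto simp: block_cut_verts_def)
    qed
    then show "S \<union> (\<Union>v\<in>block_cut_verts G B - W. verts (branch G B v)) \<subseteq> kept"
      using block_kept branch_eq(1) by auto
    show "kept \<subseteq> S \<union> (\<Union>v\<in>block_cut_verts G B - W. verts (branch G B v))"
    proof
      fix u assume u: "u \<in> kept"
      show "u \<in> S \<union> (\<Union>v\<in>block_cut_verts G B - W. verts (branch G B v))"
      proof (cases "u \<in> S")
        case False
        then obtain v where v: "v \<in> block_cut_verts G B" "u \<in> side v"
          using side_cover[of u] u by (auto simp: kept_def)
        then have "v \<notin> W" using u kept_side by blast
        then show ?thesis using v branch_eq(1)[OF v(1)] by blast
      qed simp
    qed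
  qed
  then show ?thesis by (simp add: whiskered_def)
qed

lemma edges_whiskered:
  "edges H = (`) Inl ` {e \<in> edges G. e \<subseteq> kept} \<union> {{Inl v, Inr v} |v. v \<in> W}"
proof -
  have vH: "S \<union> (\<Union>v\<in>block_cut_verts G B - W. verts (branch G B v)) = kept"
  proof -
    have "Inl ` (S \<union> (\<Union>v\<in>block_cut_verts G B - W. verts (branch G B v))) \<union> Inr ` W = Inl ` kept \<union> (Inr ` W :: ('a + 'a) set)"
      using verts_whiskered by (simp add: whiskered_def)
    then show ?thesis by blast
  qed
  have "edges B \<union> (\<Union>v\<in>block_cut_verts G B - W. edges (branch G B v)) = {e \<in> edges G. e \<subseteq> kept}"
  proof
    show "edges B \<union> (\<Union>v\<in>block_cut_verts G B - W. edges (branch G B v)) \<subseteq> {e \<in> edges G. e \<subseteq> kept}"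
      unfolding vH[symmetric] using block_eq(3) branch_eq by auto
    show "{e \<in> edges G. e \<subseteq> kept} \<subseteq> edges B \<union> (\<Union>v\<in>block_cut_verts G B - W. edges (branch G B v))"
    proof
      fix e assume e: "e \<in> {e \<in> edges G. e \<subseteq> kept}"
      show "e \<in> edges B \<union> (\<Union>v\<in>block_cut_verts G B - W. edges (branch G B v))"
      proof (cases "e \<subseteq> S")
        case True
        then show ?thesis using e by (simp add: block_eq(3))
      next
        case False
        then obtain a where a: "a \<in> e" "a \<notin> S" by blast
        have "card e = 2" using e G by (auto simp: simple_graph_def)
        then obtain b where b: "e = {a, b}" using a(1) by (metis card_2_iff doubleton_eq_iff insertE singletonD)
        obtain v where v: "v \<in> block_cut_verts G B" "a \<in> side v"
          using side_cover[of a] a e by (auto simp: kept_def)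
        then have "v \<notin> W" using a e kept_side by blast
        moreover have "e \<subseteq> insert v (side v)" using side_edge[OF v(1) _ v(2), of b] e v(2) by (auto simp: b)
        ultimately show ?thesis using v(1) e branch_eq(2)[OF v(1)] by blast
      qed
    qed
  qed
  then show ?thesis by (simp add: whiskered_def)
qed

lemma simple_whiskered: "simple_graph H"
  using simple_graph_whiskered[OF G block W] .

text \<open>
  The whiskered graph is the contraction of \<open>G\<close> in which the side of each \<open>v \<in> W\<close> becomes the leaf at \<open>v\<close>.
  The contraction and a section of it relate linkedness in the two graphs.
\<close>

definition contract :: "'a \<Rightarrow> 'a + 'a" where
  "contract u = (if u \<in> kept then Inl u else Inr (SOME v. v \<in> W \<and> u \<in> side v))"

definition lift :: "'a + 'a \<Rightarrow> 'a" where
  "lift y = (case y of Inl u \<Rightarrow> u | Inr v \<Rightarrow> (SOME u. u \<in> side v))"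

lemma contract_kept: "u \<in> kept \<Longrightarrow> contract u = Inl u"
  by (simp add: contract_def)

lemma contract_side:
  assumes "v \<in> W" "u \<in> side v"
  shows "contract u = Inr v"
proof -
  have "(SOME v. v \<in> W \<and> u \<in> side v) = v"
    by (rule some_equality) (use assms side_disjoint W in blast)+
  then show ?thesis using kept_side[OF assms] by (simp add: contract_def)
qed

lemma lift_Inl: "lift (Inl u) = u"
  by (simp add: lift_def)

lemma lift_Inr: "v \<in> W \<Longrightarrow> lift (Inr v) \<in> side v"
  using side_attached[of v] W someI[of "\<lambda>u. u \<in> side v"] by (auto simp: lift_def)

lemma contract_lift: "y \<in> verts H \<Longrightarrow> contract (lift y) = y"
  using contract_kept contract_side lift_Inr by (auto simp: verts_whiskered lift_Inl)

lemma contract_verts: "u \<in> verts G \<Longrightarrow> contract u \<in> verts H"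
  using contract_kept contract_side not_kept by (cases "u \<in> kept") (fastforce simp: verts_whiskered)+

text \<open>
  The contracted sides are connected and avoid \<open>T\<close>, and each of them is joined to the rest by its
  vertex \<open>v\<close> alone. So the contraction induces a bijection between components.
\<close>

lemma card_components_whiskered:
  assumes T: "T \<subseteq> kept"
  shows "card (components (remove H (Inl ` T))) = card (components (remove G T))"
proof -
  let ?G = "remove G T" and ?H = "remove H (Inl ` T)"
  have sG: "simple_graph ?G" and sH: "simple_graph ?H"
    using simple_graph_remove G simple_whiskered by blast+
  have T_side: "T \<inter> side v = {}" if "v \<in> W" for v using T kept_side[OF that] by blast
  have cv: "contract u \<in> verts ?H" if uG: "u \<in> verts ?G" for u
  proof (cases "u \<in> kept")
    case True
    then show ?thesis using uG contract_verts[of u] by (auto simp: contract_kept)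
  next
    case False
    then obtain v where "v \<in> W" "u \<in> side v" using uG not_kept by auto
    then show ?thesis using uG contract_verts[of u] by (auto simp: contract_side)
  qed
  have lv: "lift y \<in> verts ?G" if "y \<in> verts ?H" for y
    using that lift_Inr kept_side T by (auto simp: verts_whiskered lift_Inl kept_def)
  have edge_H: "(contract a, contract b) \<in> linked ?H" if ab: "{a, b} \<in> edges ?G" for a b
  proof -
    have e: "{a, b} \<in> edges G" "a \<in> verts ?G" "b \<in> verts ?G"
      using ab simple_graph_edge[OF sG ab] by (auto simp: edges_remove)
    have one: "(contract a, contract b) \<in> linked ?H"
      if ab: "{a, b} \<in> edges G" "a \<in> verts ?G" "b \<in> verts ?G" "a \<notin> kept" for a b
    proof -
      obtain v where v: "v \<in> W" "a \<in> side v" using ab(2,4) not_kept by auto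
      have a: "contract a = Inr v" using v by (rule contract_side)
      have "b = v \<or> b \<in> side v" using side_edge[of v a b] v W ab(1) by blast
      then show ?thesis
      proof
        assume b: "b = v"
        have "{Inr v, Inl v} \<in> edges ?H"
          using v(1) ab(3) W_kept b by (auto simp: edges_remove edges_whiskered verts_whiskered insert_commute)
        then show ?thesis using linked_edge[OF sH] v(1) W_kept contract_kept by (auto simp: a b)
      next
        assume "b \<in> side v"
        then show ?thesis using cv[OF ab(2)] contract_side[OF v(1)] by (simp add: a linked_refl)
      qed
    qed
    show ?thesis
    proof (cases "a \<in> kept \<and> b \<in> kept")
      case True
      then have "Inl ` {a, b} \<in> edges H" using e(1) unfolding edges_whiskered by blast
      then have "{Inl a, Inl b} \<in> edges ?H"
        using e True by (auto simp: edges_remove verts_whiskered)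
      then show ?thesis using linked_edge[OF sH] True by (simp add: contract_kept)
    next
      case False
      then show ?thesis
        using one[of a b] one[of b a] e linked_sym by (auto simp: insert_commute)
    qed
  qed
  have edge_G: "(lift y, lift z) \<in> linked ?G" if yz: "{y, z} \<in> edges ?H" for y z
  proof -
    have e: "{y, z} \<in> edges H" "y \<in> verts ?H" "z \<in> verts ?H"
      using yz simple_graph_edge[OF sH yz] by (auto simp: edges_remove)
    have whisker: "(lift (Inr v), lift (Inl v)) \<in> linked ?G" if v: "v \<in> W" "Inl v \<in> verts ?H" for v
    proof -
      have "v \<in> block_cut_verts G B" "v \<notin> T" using v W by auto
      then show ?thesis
        using side_linked_root[OF _ T_side[OF v(1)] _ lift_Inr[OF v(1)]] by (simp add: lift_Inl)
    qed
    consider e' where "{y, z} = Inl ` e'" "e' \<in> edges G" | v where "{y, z} = {Inl v, Inr v}" "v \<in> W"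
      using e(1) unfolding edges_whiskered by blast
    then show ?thesis
    proof cases
      case 1
      have "y \<in> Inl ` e'" "z \<in> Inl ` e'" unfolding 1(1)[symmetric] by simp_all
      then obtain a b where ab: "y = Inl a" "z = Inl b" by (elim imageE)
      have "Inl ` {a, b} = (Inl ` e' :: ('a + 'a) set)" using 1(1) by (simp add: ab)
      then have "e' = {a, b}" by (simp only: inj_image_eq_iff[OF inj_Inl])
      then have "{a, b} \<in> edges ?G"
        using 1(2) e(2,3) lv[of y] lv[of z] by (simp add: ab lift_Inl edges_remove)
      then show ?thesis using linked_edge[OF sG] by (simp add: ab lift_Inl)
    next
      case 2
      then have "(y = Inl v \<and> z = Inr v) \<or> (y = Inr v \<and> z = Inl v)" by (simp add: doubleton_eq_iff)
      then show ?thesis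
      proof (elim disjE conjE)
        assume "y = Inl v" "z = Inr v"
        then show ?thesis using linked_sym[OF whisker[OF 2(2)]] e(2) by simp
      next
        assume "y = Inr v" "z = Inl v"
        then show ?thesis using whisker[OF 2(2)] e(3) by simp
      qed
    qed
  qed
  have fibre: "(u, lift (contract u)) \<in> linked ?G" if u: "u \<in> verts ?G" for u
  proof (cases "u \<in> kept")
    case True
    then show ?thesis using u by (simp add: contract_kept lift_Inl linked_refl)
  next
    case False
    then obtain v where v: "v \<in> W" "u \<in> side v" using u not_kept by auto
    then show ?thesis
      using side_linked[OF subsetD[OF W v(1)] T_side[OF v(1)] v(2) lift_Inr[OF v(1)]]
      by (simp add: contract_side[OF v])
  qed
  show ?thesis
  proof (rule antisym)
    show "card (components ?H) \<le> card (components ?G)"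
    proof (rule card_components_le[OF sG lv])
      fix y z assume yz: "y \<in> verts ?H" "z \<in> verts ?H" "(lift y, lift z) \<in> linked ?G"
      have "(contract (lift y), contract (lift z)) \<in> linked ?H"
        by (rule linked_map[OF sG yz(3) cv edge_H])
      then show "(y, z) \<in> linked ?H" using yz by (simp add: contract_lift)
    qed
    show "card (components ?G) \<le> card (components ?H)"
    proof (rule card_components_le[OF sH cv])
      fix u w assume uw: "u \<in> verts ?G" "w \<in> verts ?G" "(contract u, contract w) \<in> linked ?H"
      have "(lift (contract u), lift (contract w)) \<in> linked ?G"
        by (rule linked_map[OF sH uw(3) lv edge_G])
      then show "(u, w) \<in> linked ?G"
        by (rule linked_trans[OF fibre[OF uw(1)] linked_trans[OF _ linked_sym[OF fibre[OF uw(2)]]]])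
    qed
  qed
qed

lemma cutset_whiskered_iff:
  assumes T: "T \<subseteq> kept"
  shows "cutset H (Inl ` T) \<longleftrightarrow> cutset G T"
proof -
  have "cut_vertex (remove H (Inl ` T - {Inl t})) (Inl t) \<longleftrightarrow> cut_vertex (remove G (T - {t})) t"
    if t: "t \<in> T" for t
  proof -
    have eq: "Inl ` T - {Inl t} = (Inl ` (T - {t}) :: ('a + 'a) set)" by auto
    have "Inl t \<in> verts H" "t \<in> verts G" using t T by (auto simp: verts_whiskered kept_def)
    moreover have "remove (remove H (Inl ` (T - {t}))) {Inl t} = remove H (Inl ` T)"
      "remove (remove G (T - {t})) {t} = remove G T"
      using t by (auto simp: remove_remove insert_absorb intro!: arg_cong[of _ _ "remove H"])
    ultimately show ?thesis
      unfolding eq cut_vertex_def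
      using t card_components_whiskered[OF T] card_components_whiskered[of "T - {t}", OF subset_trans[OF Diff_subset T]]
      by auto
  qed
  moreover have "Inl ` T \<subseteq> verts H" "T \<subseteq> verts G" using T by (auto simp: verts_whiskered kept_def)
  ultimately show ?thesis unfolding cutset_def by auto
qed

text \<open>
  A leaf has a single neighbour, so it separates no two of its neighbours in any subgraph.
\<close>

lemma cutset_whiskered:
  assumes T: "cutset H T'"
  shows "\<exists>T \<subseteq> kept. T' = Inl ` T"
proof -
  have "Inr v \<notin> T'" for v
  proof
    assume v: "Inr v \<in> T'"
    let ?K = "remove H (T' - {Inr v})"
    have K: "simple_graph ?K" using simple_whiskered by (rule simple_graph_remove)
    obtain i j where ij: "{Inr v, i} \<in> edges ?K" "{Inr v, j} \<in> edges ?K" "(i, j) \<notin> linked (remove ?K {Inr v})"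
      using T v unfolding cutset_def cut_vertex_iff[OF K] by (metis cut_vertex_iff[OF K])
    have "i = Inl v" if "{Inr v, i} \<in> edges ?K" for i
      using that by (auto simp: edges_remove edges_whiskered doubleton_eq_iff)
    then have "i = j" using ij by blast
    moreover have "i \<in> verts (remove ?K {Inr v})" using simple_graph_edge[OF K ij(1)] by auto
    ultimately show False using ij(3) linked_refl by fast
  qed
  then have "T' \<subseteq> Inl ` kept" using T unfolding cutset_def verts_whiskered by blast
  then show ?thesis by (simp add: subset_image_iff)
qed

end

end

lemma accessible_whiskered:
  fixes G B :: "'a graph"
  assumes G: "simple_graph G" "graph_connected G" and acc: "accessible TYPE('k::field) G"
    and B: "is_block G B" and W: "W \<subseteq> block_cut_verts G B"
  shows "accessible TYPE('k) (whiskered G B W)"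
proof -
  let ?H = "whiskered G B W"
  have H: "simple_graph ?H" by (rule simple_graph_whiskered[OF G(1) B W])
  have unm: "\<forall>T. cutset G T \<longrightarrow> card (components (remove G T)) = card T + card (components G)"
    using acc unfolding accessible_def unmixed_iff[OF G(1)] by blast
  note ctxt = G B unm W
  note count = card_components_whiskered[OF ctxt] and cutset_eq = cutset_whiskered_iff[OF ctxt]
  have cutsets: "\<exists>T. T \<subseteq> kept G B W \<and> T' = Inl ` T \<and> cutset G T" if "cutset ?H T'" for T'
    using cutset_whiskered[OF ctxt that] cutset_eq that by blast
  have whole: "card (components ?H) = card (components G)"
    using count[of "{}"] by (simp add: remove_empty[OF G(1)] remove_empty[OF H])
  show ?thesis
    unfolding accessible_def unmixed_iff[OF H]
  proof (intro conjI allI impI)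
    fix T' assume "cutset ?H T'"
    then obtain T where T: "T \<subseteq> kept G B W" "T' = Inl ` T" "cutset G T" using cutsets by blast
    then show "card (components (remove ?H T')) = card T' + card (components ?H)"
      using count[OF T(1)] unm T(3) whole by (simp add: card_image)
  next
    fix T' assume T': "cutset ?H T' \<and> T' \<noteq> {}"
    then obtain T where T: "T \<subseteq> kept G B W" "T' = Inl ` T" "cutset G T" using cutsets by blast
    then obtain t where t: "t \<in> T" "cutset G (T - {t})" using acc T' unfolding accessible_def by blast
    then have "cutset ?H (Inl ` (T - {t}))" using T(1) by (subst cutset_eq) auto
    moreover have "Inl ` (T - {t}) = T' - {Inl t}" using T(2) by auto
    ultimately show "\<exists>t\<in>T'. cutset ?H (T' - {t})" using t(1) T(2) by (intro bexI[of _ "Inl t"]) auto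
  qed
qed


theorem theorem3p9:
  fixes G B :: "'a graph"
  assumes "simple_graph G"
    and "graph_connected G"
    and "accessible TYPE('k::field) G"
    and "is_block G B"
  shows "(\<forall>W. W \<subseteq> block_cut_verts G B \<longrightarrow> accessible TYPE('k) (whiskered G B W))
    \<and> accessible TYPE('k) (whiskered G B (block_cut_verts G B))"
  using accessible_whiskered[OF assms] by blast

end
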